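(* Let $R$ be a principal ideal domain containing $\frac12$. Given morphisms of commutative differential graded algebras over $R$, $\eta:(A,d_A)\to(B,d_B)$ and $\psi:(\Lambda V,d)\to(B,d_B)$, such that (i) $(\Lambda V,d)$ is a minimal cdga; (ii) $\eta$ is a surjective quasi-isomorphism; there exists a morphism of commutative differential graded algebras $\varphi:(\Lambda V,d)\to(A,d_A)$ such that $\eta\circ\varphi=\psi$.
   Context: Commutative differential graded algebras (cdga's) are graded commutative and cohomologically graded with differential of degree $+1$; a quasi-isomorphism is a morphism inducing an isomorphism in (co)homology. $\Lambda V$ denotes the free graded commutative algebra on a free graded $R$-module $V$. Here a minimal cdga is a cdga $(\Lambda V,d)$ arising as a commutative model: $V=\bigcup_k V(k)$ is the union of an increasing sequence of graded free submodules $0=V(0)\subset V(1)\subset V(2)\subset\cdots$, each $V(k)$ being the direct sum of $V(k-1)$ and a free module, with $d:V(k)\to\Lambda(V(k-1))$; and, moreover, $d:V\to\Lambda^{\ge2}V$ (decomposable differential) if $R$ is a field, while if $R$ is not a field, for each $i$ there is a non-invertible $r_i\in R$ such that the linear part of $d$ maps $V^i$ into $r_iV^{i+1}$. *)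

theory Defs
  imports "HOL-Algebra.Module" "HOL-Algebra.QuotRing" "HOL-Algebra.Ring_Divisibility"
begin

section \<open>Graded modules and graded commutative algebras\<close>

text \<open>
  Gradings are internal and indexed by the integers; non-negatively graded objects are those whose
  homogeneous parts of negative degree are zero.
\<close>

record ('r, 'a) grmod = "('r, 'a) module" +
  homog :: "int \<Rightarrow> 'a set"

locale graded_module = module R M
  for R :: "('r, 'm) ring_scheme" (structure) and M :: "('r, 'a) grmod" (structure) +
  assumes homog_submodule: "submodule (homog M i) R M"
    and homog_decomposition:
      "x \<in> carrier M \<Longrightarrow>
        \<exists>!f. (\<forall>i::int. f i \<in> homog M i) \<and> finite {i. f i \<noteq> \<zero>\<^bsub>M\<^esub>} \<and>
             x = finsum M f {i. f i \<noteq> \<zero>\<^bsub>M\<^esub>}"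

definition signed :: "('a, 'm) ring_scheme \<Rightarrow> int \<Rightarrow> 'a \<Rightarrow> 'a" where
  "signed A k x = (if even k then x else \<ominus>\<^bsub>A\<^esub> x)"

locale graded_comm_algebra = graded_module R A + ring A
  for R :: "('r, 'm) ring_scheme" (structure) and A :: "('r, 'a) grmod" (structure) +
  assumes smult_mult_left:
      "\<lbrakk>r \<in> carrier R; x \<in> carrier A; y \<in> carrier A\<rbrakk> \<Longrightarrow>
        (r \<odot>\<^bsub>A\<^esub> x) \<otimes>\<^bsub>A\<^esub> y = r \<odot>\<^bsub>A\<^esub> (x \<otimes>\<^bsub>A\<^esub> y)"
    and smult_mult_right:
      "\<lbrakk>r \<in> carrier R; x \<in> carrier A; y \<in> carrier A\<rbrakk> \<Longrightarrow>
        x \<otimes>\<^bsub>A\<^esub> (r \<odot>\<^bsub>A\<^esub> y) = r \<odot>\<^bsub>A\<^esub> (x \<otimes>\<^bsub>A\<^esub> y)"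
    and one_homog: "\<one>\<^bsub>A\<^esub> \<in> homog A 0"
    and mult_homog: "\<lbrakk>x \<in> homog A i; y \<in> homog A j\<rbrakk> \<Longrightarrow> x \<otimes>\<^bsub>A\<^esub> y \<in> homog A (i + j)"
    and graded_commutative:
      "\<lbrakk>x \<in> homog A i; y \<in> homog A j\<rbrakk> \<Longrightarrow> x \<otimes>\<^bsub>A\<^esub> y = signed A (i * j) (y \<otimes>\<^bsub>A\<^esub> x)"

definition linear_map ::
  "('r, 'm) ring_scheme \<Rightarrow> ('r, 'a) grmod \<Rightarrow> ('r, 'b) grmod \<Rightarrow> ('a \<Rightarrow> 'b) \<Rightarrow> bool" where
  "linear_map R M N f \<longleftrightarrow>
     f \<in> carrier M \<rightarrow> carrier N \<and>
     (\<forall>x\<in>carrier M. \<forall>y\<in>carrier M. f (x \<oplus>\<^bsub>M\<^esub> y) = f x \<oplus>\<^bsub>N\<^esub> f y) \<and>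
     (\<forall>r\<in>carrier R. \<forall>x\<in>carrier M. f (r \<odot>\<^bsub>M\<^esub> x) = r \<odot>\<^bsub>N\<^esub> f x)"

section \<open>Commutative differential graded algebras\<close>

locale cdga = graded_comm_algebra R A
  for R :: "('r, 'm) ring_scheme" (structure) and A :: "('r, 'a) grmod" (structure) +
  fixes d :: "'a \<Rightarrow> 'a"
  assumes diff_linear: "linear_map R A A d"
    and diff_degree: "x \<in> homog A i \<Longrightarrow> d x \<in> homog A (i + 1)"
    and diff_diff: "x \<in> carrier A \<Longrightarrow> d (d x) = \<zero>\<^bsub>A\<^esub>"
    and leibniz:
      "\<lbrakk>x \<in> homog A i; y \<in> carrier A\<rbrakk> \<Longrightarrow>
        d (x \<otimes>\<^bsub>A\<^esub> y) = (d x \<otimes>\<^bsub>A\<^esub> y) \<oplus>\<^bsub>A\<^esub> signed A i (x \<otimes>\<^bsub>A\<^esub> d y)"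

definition cdga_morphism ::
  "('r, 'm) ring_scheme \<Rightarrow> ('r, 'a) grmod \<Rightarrow> ('a \<Rightarrow> 'a) \<Rightarrow> ('r, 'b) grmod \<Rightarrow> ('b \<Rightarrow> 'b)
    \<Rightarrow> ('a \<Rightarrow> 'b) \<Rightarrow> bool" where
  "cdga_morphism R A dA B dB f \<longleftrightarrow>
     f \<in> ring_hom A B \<and> linear_map R A B f \<and>
     (\<forall>i. f ` homog A i \<subseteq> homog B i) \<and>
     (\<forall>x\<in>carrier A. f (dA x) = dB (f x))"

definition coboundaries :: "('r, 'a) grmod \<Rightarrow> ('a \<Rightarrow> 'a) \<Rightarrow> 'a set" where
  "coboundaries A d = d ` carrier A"

definition cohomology :: "('r, 'a) grmod \<Rightarrow> ('a \<Rightarrow> 'a) \<Rightarrow> 'a set ring" where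
  "cohomology A d = A\<lparr>carrier := {x \<in> carrier A. d x = \<zero>\<^bsub>A\<^esub>}\<rparr> Quot coboundaries A d"

text \<open>The map sending the class of a cocycle \<open>x\<close> to the class of \<open>f x\<close>.\<close>

definition cohomology_map ::
  "('r, 'b) grmod \<Rightarrow> ('b \<Rightarrow> 'b) \<Rightarrow> ('a \<Rightarrow> 'b) \<Rightarrow> 'a set \<Rightarrow> 'b set" where
  "cohomology_map B dB f C = (\<Union>x\<in>C. coboundaries B dB +>\<^bsub>B\<^esub> f x)"

text \<open>
  The cohomology ring is the direct sum of the modules \<open>H\<^sup>i\<close>, and the map induced by a morphism is
  linear and preserves this decomposition, so it is an isomorphism of rings if and only if it is an
  isomorphism of graded algebras, if and only if it is an isomorphism in each degree.
\<close>

definition quasi_isomorphism ::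
  "('r, 'm) ring_scheme \<Rightarrow> ('r, 'a) grmod \<Rightarrow> ('a \<Rightarrow> 'a) \<Rightarrow> ('r, 'b) grmod \<Rightarrow> ('b \<Rightarrow> 'b)
    \<Rightarrow> ('a \<Rightarrow> 'b) \<Rightarrow> bool" where
  "quasi_isomorphism R A dA B dB f \<longleftrightarrow>
     cdga_morphism R A dA B dB f \<and>
     cohomology_map B dB f \<in> ring_iso (cohomology A dA) (cohomology B dB)"

section \<open>Free modules\<close>

definition is_basis :: "('r, 'm) ring_scheme \<Rightarrow> ('r, 'v) grmod \<Rightarrow> 'v set \<Rightarrow> bool" where
  "is_basis R M S \<longleftrightarrow> S \<subseteq> carrier M \<and>
     (\<forall>x\<in>carrier M. \<exists>!c. (\<forall>b. c b \<in> carrier R) \<and>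
        finite {b. c b \<noteq> \<zero>\<^bsub>R\<^esub>} \<and> {b. c b \<noteq> \<zero>\<^bsub>R\<^esub>} \<subseteq> S \<and>
        x = finsum M (\<lambda>b. c b \<odot>\<^bsub>M\<^esub> b) {b. c b \<noteq> \<zero>\<^bsub>R\<^esub>})"

definition free_module :: "('r, 'm) ring_scheme \<Rightarrow> ('r, 'v) grmod \<Rightarrow> bool" where
  "free_module R M \<longleftrightarrow> module R M \<and> (\<exists>S. is_basis R M S)"

definition graded_free_module :: "('r, 'm) ring_scheme \<Rightarrow> ('r, 'v) grmod \<Rightarrow> bool" where
  "graded_free_module R V \<longleftrightarrow>
     graded_module R V \<and> (\<forall>i. free_module R (V\<lparr>carrier := homog V i\<rparr>))"

definition graded_free_submodule ::
  "('r, 'm) ring_scheme \<Rightarrow> ('r, 'v) grmod \<Rightarrow> 'v set \<Rightarrow> bool" where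
  "graded_free_submodule R V W \<longleftrightarrow> submodule W R V \<and>
     graded_free_module R (V\<lparr>carrier := W, homog := \<lambda>i. homog V i \<inter> W\<rparr>)"

definition internal_direct_sum :: "('r, 'v) grmod \<Rightarrow> 'v set \<Rightarrow> 'v set \<Rightarrow> 'v set \<Rightarrow> bool" where
  "internal_direct_sum V U P Q \<longleftrightarrow> U = P <+>\<^bsub>V\<^esub> Q \<and> P \<inter> Q = {\<zero>\<^bsub>V\<^esub>}"

section \<open>The free graded commutative algebra on a graded module\<close>

text \<open>
  The free associative algebra on a set of letters: finitely supported functions from words to
  coefficients, with the convolution product along concatenation of words.
\<close>

definition free_algebra :: "('r, 'm) ring_scheme \<Rightarrow> 's set \<Rightarrow> ('r, 's list \<Rightarrow> 'r) module" where
  "free_algebra R S =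
     \<lparr>carrier = {p. (\<forall>w. p w \<in> carrier R) \<and> finite {w. p w \<noteq> \<zero>\<^bsub>R\<^esub>} \<and>
                    (\<forall>w. p w \<noteq> \<zero>\<^bsub>R\<^esub> \<longrightarrow> set w \<subseteq> S)},
      monoid.mult = (\<lambda>p q w. finsum R (\<lambda>k. p (take k w) \<otimes>\<^bsub>R\<^esub> q (drop k w)) {..length w}),
      one = (\<lambda>w. if w = [] then \<one>\<^bsub>R\<^esub> else \<zero>\<^bsub>R\<^esub>),
      ring.zero = (\<lambda>w. \<zero>\<^bsub>R\<^esub>),
      add = (\<lambda>p q w. p w \<oplus>\<^bsub>R\<^esub> q w),
      smult = (\<lambda>r p w. r \<otimes>\<^bsub>R\<^esub> p w)\<rparr>"

definition letter :: "('r, 'm) ring_scheme \<Rightarrow> 's \<Rightarrow> 's list \<Rightarrow> 'r" where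
  "letter R v w = (if w = [v] then \<one>\<^bsub>R\<^esub> else \<zero>\<^bsub>R\<^esub>)"

text \<open>
  The algebra \<open>\<Lambda>V\<close> is the tensor algebra of \<open>V\<close> modulo graded commutators. The tensor algebra is
  itself presented as the free associative algebra on the elements of \<open>V\<close>, modulo the relations
  making the inclusion of \<open>V\<close> linear; these are the first two families below. The relations
  \<open>v\<^sup>2 = 0\<close> for \<open>v\<close> of odd degree follow from the last family because 2 is invertible in \<open>R\<close>.
\<close>

definition gca_relations ::
  "('r, 'm) ring_scheme \<Rightarrow> ('r, 'v) grmod \<Rightarrow> ('v list \<Rightarrow> 'r) set" where
  "gca_relations R V = (let F = free_algebra R (carrier V) in
     {letter R (v \<oplus>\<^bsub>V\<^esub> w) \<ominus>\<^bsub>F\<^esub> (letter R v \<oplus>\<^bsub>F\<^esub> letter R w) |v w.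
        v \<in> carrier V \<and> w \<in> carrier V} \<union>
     {letter R (r \<odot>\<^bsub>V\<^esub> v) \<ominus>\<^bsub>F\<^esub> (r \<odot>\<^bsub>F\<^esub> letter R v) |r v.
        r \<in> carrier R \<and> v \<in> carrier V} \<union>
     {(letter R v \<otimes>\<^bsub>F\<^esub> letter R w) \<ominus>\<^bsub>F\<^esub> signed F (i * j) (letter R w \<otimes>\<^bsub>F\<^esub> letter R v) |v w i j.
        v \<in> homog V i \<and> w \<in> homog V j})"

definition gca_ideal :: "('r, 'm) ring_scheme \<Rightarrow> ('r, 'v) grmod \<Rightarrow> ('v list \<Rightarrow> 'r) set" where
  "gca_ideal R V = genideal (free_algebra R (carrier V)) (gca_relations R V)"

definition gca_class ::
  "('r, 'm) ring_scheme \<Rightarrow> ('r, 'v) grmod \<Rightarrow> ('v list \<Rightarrow> 'r) \<Rightarrow> ('v list \<Rightarrow> 'r) set" where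
  "gca_class R V p = gca_ideal R V +>\<^bsub>free_algebra R (carrier V)\<^esub> p"

text \<open>
  The classes of the linear combinations of words satisfying \<open>P\<close>.
\<close>

definition gca_span ::
  "('r, 'm) ring_scheme \<Rightarrow> ('r, 'v) grmod \<Rightarrow> ('v list \<Rightarrow> bool) \<Rightarrow> ('v list \<Rightarrow> 'r) set set" where
  "gca_span R V P =
     gca_class R V ` {p \<in> carrier (free_algebra R (carrier V)). \<forall>w. p w \<noteq> \<zero>\<^bsub>R\<^esub> \<longrightarrow> P w}"

definition word_of_degree :: "('r, 'v) grmod \<Rightarrow> int \<Rightarrow> 'v list \<Rightarrow> bool" where
  "word_of_degree V n w \<longleftrightarrow> (\<exists>ks. list_all2 (\<lambda>v k. v \<in> homog V k) w ks \<and> sum_list ks = n)"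

definition free_gca ::
  "('r, 'm) ring_scheme \<Rightarrow> ('r, 'v) grmod \<Rightarrow> ('r, ('v list \<Rightarrow> 'r) set) grmod" where
  "free_gca R V = (let F = free_algebra R (carrier V); Q = F Quot gca_ideal R V in
     \<lparr>carrier = carrier Q, monoid.mult = monoid.mult Q, one = one Q, ring.zero = ring.zero Q, add = add Q,
      smult = (\<lambda>r C. \<Union>p\<in>C. gca_class R V (r \<odot>\<^bsub>F\<^esub> p)),
      homog = (\<lambda>n. gca_span R V (word_of_degree V n))\<rparr>)"

definition gca_incl ::
  "('r, 'm) ring_scheme \<Rightarrow> ('r, 'v) grmod \<Rightarrow> 'v \<Rightarrow> ('v list \<Rightarrow> 'r) set" where
  "gca_incl R V v = gca_class R V (letter R v)"

text \<open>
  For a submodule \<open>W\<close> of \<open>V\<close>, the image of \<open>\<Lambda>W\<close> in \<open>\<Lambda>V\<close>. The map from \<open>\<Lambda>W\<close> to \<open>\<Lambda>V\<close> is injective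
  when \<open>W\<close> has a graded complement in \<open>V\<close>, as is the case for all stages of the filtrations below.
\<close>

definition sub_gca ::
  "('r, 'm) ring_scheme \<Rightarrow> ('r, 'v) grmod \<Rightarrow> 'v set \<Rightarrow> ('v list \<Rightarrow> 'r) set set" where
  "sub_gca R V W = gca_span R V (\<lambda>w. set w \<subseteq> W)"

text \<open>The direct sum of the \<open>\<Lambda>\<^sup>nV\<close> for \<open>n\<close> in \<open>N\<close>, where \<open>\<Lambda>\<^sup>nV\<close> is spanned by products of \<open>n\<close>
  elements of \<open>V\<close>.\<close>

definition word_length_part ::
  "('r, 'm) ring_scheme \<Rightarrow> ('r, 'v) grmod \<Rightarrow> nat set \<Rightarrow> ('v list \<Rightarrow> 'r) set set" where
  "word_length_part R V N = gca_span R V (\<lambda>w. length w \<in> N)"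

text \<open>The projection of \<open>\<Lambda>V\<close> onto \<open>\<Lambda>\<^sup>1V\<close>, the copy of \<open>V\<close> in \<open>\<Lambda>V\<close>.\<close>

definition linear_component ::
  "('r, 'm) ring_scheme \<Rightarrow> ('r, 'v) grmod \<Rightarrow> ('v list \<Rightarrow> 'r) set \<Rightarrow> ('v list \<Rightarrow> 'r) set" where
  "linear_component R V x =
     (THE y. y \<in> word_length_part R V {1} \<and>
             x \<ominus>\<^bsub>free_gca R V\<^esub> y \<in> word_length_part R V (- {1}))"

section \<open>Minimal algebras\<close>

definition model_filtration ::
  "('r, 'm) ring_scheme \<Rightarrow> ('r, 'v) grmod \<Rightarrow> (('v list \<Rightarrow> 'r) set \<Rightarrow> ('v list \<Rightarrow> 'r) set)
    \<Rightarrow> (nat \<Rightarrow> 'v set) \<Rightarrow> bool" where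
  "model_filtration R V d Vs \<longleftrightarrow>
     (\<forall>k. graded_free_submodule R V (Vs k)) \<and>
     Vs 0 = {\<zero>\<^bsub>V\<^esub>} \<and>
     (\<forall>k. Vs k \<subseteq> Vs (Suc k)) \<and>
     carrier V = (\<Union>k. Vs k) \<and>
     (\<forall>k. \<exists>W. graded_free_submodule R V W \<and> internal_direct_sum V (Vs (Suc k)) (Vs k) W) \<and>
     (\<forall>k. \<forall>v\<in>Vs (Suc k). d (gca_incl R V v) \<in> sub_gca R V (Vs k))"

definition minimality_condition ::
  "('r, 'm) ring_scheme \<Rightarrow> ('r, 'v) grmod \<Rightarrow> (('v list \<Rightarrow> 'r) set \<Rightarrow> ('v list \<Rightarrow> 'r) set)
    \<Rightarrow> bool" where
  "minimality_condition R V d \<longleftrightarrow>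
     (if field R
      then \<forall>v\<in>carrier V. d (gca_incl R V v) \<in> word_length_part R V {2..}
      else \<forall>i. \<exists>r\<in>carrier R. r \<notin> Units R \<and>
             (\<forall>v\<in>homog V i. linear_component R V (d (gca_incl R V v))
                \<in> (\<lambda>u. gca_incl R V (r \<odot>\<^bsub>V\<^esub> u)) ` homog V (i + 1)))"

definition minimal_cdga ::
  "('r, 'm) ring_scheme \<Rightarrow> ('r, 'v) grmod \<Rightarrow> (('v list \<Rightarrow> 'r) set \<Rightarrow> ('v list \<Rightarrow> 'r) set)
    \<Rightarrow> bool" where
  "minimal_cdga R V d \<longleftrightarrow>
     graded_free_module R V \<and> cdga R (free_gca R V) d \<and>
     (\<exists>Vs. model_filtration R V d Vs) \<and> minimality_condition R V d"

end

theory Submission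
  imports Defs
begin

text \<open>
  The lift is built inductively along the filtration. Given \<open>\<phi>\<close> on \<open>\<Lambda>(V(k))\<close>, a homogeneous generator
  \<open>w\<close> of a complement of \<open>V(k)\<close> in \<open>V(k+1)\<close> has \<open>dw\<close> in \<open>\<Lambda>(V(k))\<close>, and \<open>\<phi>(dw)\<close> is a cocycle with
  \<open>\<eta>(\<phi>(dw)) = d(\<psi> w)\<close>. Injectivity of \<open>H(\<eta>)\<close> gives \<open>a\<close> with \<open>da = \<phi>(dw)\<close>; surjectivity of \<open>H(\<eta>)\<close> and of
  \<open>\<eta>\<close> allows \<open>a\<close> to be corrected by a cocycle so that \<open>\<eta>(a) = \<psi> w\<close>. As the complement is free, these
  choices can be made linearly, and the universal property of \<open>\<Lambda>V\<close> turns the resulting linear map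
  \<open>V \<rightarrow> A\<close> into a morphism of algebras.
\<close>

section \<open>Homogeneous components\<close>

text \<open>Two features of the encoding shape the work. The algebra \<Lambda>V is a quotient of a
  free associative algebra whose letters are all elements of V, not those of a basis; so a graded
  linear map out of V induces a homomorphism as soon as evaluation of noncommutative polynomials
  kills the three families of relations, and no monomial basis of \<Lambda>V ever enters. Cohomology
  is an ungraded quotient ring, so injectivity and surjectivity of H(\<eta>) return elements of
  mixed degree; since differentials and morphisms are compatible with the projections onto
  homogeneous parts, taking the component of the right degree at the very end repairs this. The
  correction of a comes from writing the cocycle \<psi>(w) - \<eta>(a) of B as \<eta>(z) + du with z
  a cocycle of A; a preimage t of u turns a into a + dt + z, whose differential is still \<phi>(dw).
  Admissible pairs (w, a) are closed under sums and scalars because the old \<phi> already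
  determines \<phi>(dw); this is why a choice on a basis extends linearly.\<close>

definition component :: "('r, 'a) grmod \<Rightarrow> int \<Rightarrow> 'a \<Rightarrow> 'a" where
  "component M i x = (THE f. (\<forall>i. f i \<in> homog M i) \<and> finite {i. f i \<noteq> \<zero>\<^bsub>M\<^esub>} \<and>
     x = finsum M f {i. f i \<noteq> \<zero>\<^bsub>M\<^esub>}) i"

text \<open>Decompositions are summed over their exact supports, and the support of a sum can shrink
  by cancellation. Enlarging the index set lets two such sums be added over a common finite
  set.\<close>

lemma (in abelian_monoid) finsum_superset:
  assumes "finite J" "J' \<subseteq> J" "\<And>j. j \<in> J \<Longrightarrow> f j \<in> carrier G" "\<And>j. j \<in> J - J' \<Longrightarrow> f j = \<zero>"
  shows "finsum G f J = finsum G f J'"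
  by (rule add.finprod_mono_neutral_cong_right) (use assms in auto)

context graded_module
begin

lemma
  shows homog_carrier: "x \<in> homog M i \<Longrightarrow> x \<in> carrier M"
    and homog_zero [simp]: "\<zero>\<^bsub>M\<^esub> \<in> homog M i"
    and homog_add: "x \<in> homog M i \<Longrightarrow> y \<in> homog M i \<Longrightarrow> x \<oplus>\<^bsub>M\<^esub> y \<in> homog M i"
    and homog_smult: "r \<in> carrier R \<Longrightarrow> x \<in> homog M i \<Longrightarrow> r \<odot>\<^bsub>M\<^esub> x \<in> homog M i"
  using submoduleE[OF homog_submodule[of i]]
    subgroup.one_closed[OF submodule.axioms(1)[OF homog_submodule[of i]]] by auto

text \<open>Passing from J down to the exact support brings the sum into the shape of
  \<open>homog_decomposition\<close>. Any finite J containing the support will do, which is how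
  components of sums and multiples are computed.\<close>

lemma component_unique:
  assumes "\<And>i. f i \<in> homog M i" "finite J" "{i. f i \<noteq> \<zero>\<^bsub>M\<^esub>} \<subseteq> J" "x = finsum M f J"
  shows "component M i x = f i"
proof -
  have c: "f j \<in> carrier M" for j
    using assms(1) homog_carrier by blast
  have "x = finsum M f {i. f i \<noteq> \<zero>\<^bsub>M\<^esub>}"
    unfolding assms(4) by (rule finsum_superset) (use assms c in auto)
  moreover have "finite {i. f i \<noteq> \<zero>\<^bsub>M\<^esub>}"
    using assms(2,3) finite_subset by blast
  moreover have "x \<in> carrier M"
    unfolding assms(4) by (rule M.finsum_closed) (use c in auto)
  ultimately show ?thesis
    unfolding component_def using assms(1) the1_equality[OF homog_decomposition[of x], of f] by simp
qed

lemma
  assumes "x \<in> carrier M"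
  shows component_homog: "component M i x \<in> homog M i"
    and finite_components: "finite {i. component M i x \<noteq> \<zero>\<^bsub>M\<^esub>}"
    and finsum_components:
      "x = finsum M (\<lambda>i. component M i x) {i. component M i x \<noteq> \<zero>\<^bsub>M\<^esub>}"
  using theI'[OF homog_decomposition[OF assms]] unfolding component_def by auto

lemma component_carrier: "x \<in> carrier M \<Longrightarrow> component M i x \<in> carrier M"
  using component_homog homog_carrier by blast

lemma finsum_components_superset:
  assumes "x \<in> carrier M" "finite J" "{i. component M i x \<noteq> \<zero>\<^bsub>M\<^esub>} \<subseteq> J"
  shows "finsum M (\<lambda>i. component M i x) J = x"
  using finsum_superset[OF assms(2,3)] finsum_components[OF assms(1)] component_carrier[OF assms(1)]
  by simp

lemma component_add:
  assumes "x \<in> carrier M" "y \<in> carrier M"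
  shows "component M i (x \<oplus>\<^bsub>M\<^esub> y) = component M i x \<oplus>\<^bsub>M\<^esub> component M i y"
proof -
  let ?J = "{i. component M i x \<noteq> \<zero>\<^bsub>M\<^esub>} \<union> {i. component M i y \<noteq> \<zero>\<^bsub>M\<^esub>}"
  have J: "finite ?J" using finite_components assms by blast
  show ?thesis
  proof (rule component_unique[OF _ J])
    show "x \<oplus>\<^bsub>M\<^esub> y = (\<Oplus>\<^bsub>M\<^esub>i\<in>?J. component M i x \<oplus>\<^bsub>M\<^esub> component M i y)"
      using assms component_carrier
      by (subst M.finsum_addf) (auto simp: finsum_components_superset[OF _ J])
  qed (use assms in \<open>auto intro: homog_add component_homog\<close>)
qed

lemma component_smult:
  assumes "r \<in> carrier R" "x \<in> carrier M"
  shows "component M i (r \<odot>\<^bsub>M\<^esub> x) = r \<odot>\<^bsub>M\<^esub> component M i x"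
proof -
  let ?J = "{i. component M i x \<noteq> \<zero>\<^bsub>M\<^esub>}"
  have J: "finite ?J" using finite_components assms by blast
  show ?thesis
  proof (rule component_unique[OF _ J])
    show "r \<odot>\<^bsub>M\<^esub> x = (\<Oplus>\<^bsub>M\<^esub>i\<in>?J. r \<odot>\<^bsub>M\<^esub> component M i x)"
      using assms component_carrier
      by (subst finsum_smult_ldistr[symmetric]) (auto simp: finsum_components[symmetric] J)
  qed (use assms in \<open>auto intro: homog_smult component_homog\<close>)
qed

lemma component_of_homog:
  assumes "x \<in> homog M j"
  shows "component M i x = (if i = j then x else \<zero>\<^bsub>M\<^esub>)"
  by (rule component_unique[where J = "{j}"]) (use assms homog_carrier in auto)

text \<open>Every element is the finite sum of its components; zero needs no case of its own since
  it is homogeneous.\<close>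

lemma homog_induct [consumes 1, case_names homog add]:
  assumes x: "x \<in> carrier M"
    and homog: "\<And>i y. y \<in> homog M i \<Longrightarrow> P y"
    and add: "\<And>y z. y \<in> carrier M \<Longrightarrow> z \<in> carrier M \<Longrightarrow> P y \<Longrightarrow> P z \<Longrightarrow> P (y \<oplus>\<^bsub>M\<^esub> z)"
  shows "P x"
proof -
  have "P (finsum M (\<lambda>i. component M i x) J)" if "finite J" for J
    using that
  proof (induction J)
    case empty
    then show ?case using homog[OF homog_zero] by simp
  next
    case (insert j J)
    have "finsum M (\<lambda>i. component M i x) (insert j J) =
        component M j x \<oplus>\<^bsub>M\<^esub> finsum M (\<lambda>i. component M i x) J"
      using insert x component_carrier by (intro M.finsum_insert) auto
    then show ?case
      using insert x component_carrier homog[OF component_homog[OF x]]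
      by (auto intro!: add M.finsum_closed)
  qed
  from this[OF finite_components[OF x]] show ?thesis
    by (simp only: finsum_components[OF x, symmetric])
qed

end

section \<open>Linear maps and homogeneous components\<close>

lemma
  assumes "linear_map R M N T"
  shows linear_map_closed: "x \<in> carrier M \<Longrightarrow> T x \<in> carrier N"
    and linear_map_add:
      "x \<in> carrier M \<Longrightarrow> y \<in> carrier M \<Longrightarrow> T (x \<oplus>\<^bsub>M\<^esub> y) = T x \<oplus>\<^bsub>N\<^esub> T y"
    and linear_map_smult:
      "r \<in> carrier R \<Longrightarrow> x \<in> carrier M \<Longrightarrow> T (r \<odot>\<^bsub>M\<^esub> x) = r \<odot>\<^bsub>N\<^esub> T x"
  using assms unfolding linear_map_def by blast+

lemma linear_map_zero:
  assumes "module R M" "module R N" "linear_map R M N T"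
  shows "T \<zero>\<^bsub>M\<^esub> = \<zero>\<^bsub>N\<^esub>"
proof -
  interpret M: module R M by fact
  interpret N: module R N by fact
  have "T (\<zero>\<^bsub>R\<^esub> \<odot>\<^bsub>M\<^esub> \<zero>\<^bsub>M\<^esub>) = \<zero>\<^bsub>R\<^esub> \<odot>\<^bsub>N\<^esub> T \<zero>\<^bsub>M\<^esub>"
    by (rule linear_map_smult[OF assms(3)]) simp_all
  then show ?thesis
    using linear_map_closed[OF assms(3) M.M.zero_closed] by simp
qed

text \<open>Both sides are additive in x, so homogeneous x suffice. The shift s is 1 for
  differentials and 0 for morphisms; with these two values the lemma replaces a solution of mixed
  degree by a homogeneous one.\<close>

lemma component_linear_map:
  assumes "graded_module R M" "graded_module R N" "linear_map R M N T"
    and deg: "\<And>i x. x \<in> homog M i \<Longrightarrow> T x \<in> homog N (i + s)"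
    and "x \<in> carrier M"
  shows "component N (i + s) (T x) = T (component M i x)"
proof -
  interpret M: graded_module R M by fact
  interpret N: graded_module R N by fact
  note T = linear_map_closed[OF assms(3)] linear_map_add[OF assms(3)]
  have T0: "T \<zero>\<^bsub>M\<^esub> = \<zero>\<^bsub>N\<^esub>"
    using linear_map_zero[OF M.module_axioms N.module_axioms assms(3)] .
  show ?thesis using \<open>x \<in> carrier M\<close>
  proof (induction rule: M.homog_induct)
    case (homog j y)
    show ?case
      using N.component_of_homog[OF deg[OF homog]] M.component_of_homog[OF homog] T0 by simp
  next
    case (add y z)
    then show ?case
      by (simp add: T M.component_carrier N.component_add M.component_add)
  qed
qed

section \<open>The free associative algebra\<close>

text \<open>The coefficient is built in, so every polynomial is a plain sum of monomials and
  induction on polynomials has no case for the scalar action.\<close>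

definition monomial :: "('r, 'm) ring_scheme \<Rightarrow> 'r \<Rightarrow> 's list \<Rightarrow> 's list \<Rightarrow> 'r" where
  "monomial R r w u = (if u = w then r else \<zero>\<^bsub>R\<^esub>)"

lemma letter_eq_monomial: "letter R v = monomial R \<one>\<^bsub>R\<^esub> [v]"
  by (auto simp: letter_def monomial_def)

lemma free_algebra_simps:
  "p \<in> carrier (free_algebra R S) \<longleftrightarrow>
     (\<forall>w. p w \<in> carrier R) \<and> finite {w. p w \<noteq> \<zero>\<^bsub>R\<^esub>} \<and> (\<forall>w. p w \<noteq> \<zero>\<^bsub>R\<^esub> \<longrightarrow> set w \<subseteq> S)"
  "p \<otimes>\<^bsub>free_algebra R S\<^esub> q = (\<lambda>w. \<Oplus>\<^bsub>R\<^esub>k\<in>{..length w}. p (take k w) \<otimes>\<^bsub>R\<^esub> q (drop k w))"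
  "\<one>\<^bsub>free_algebra R S\<^esub> = monomial R \<one>\<^bsub>R\<^esub> []"
  "\<zero>\<^bsub>free_algebra R S\<^esub> = (\<lambda>w. \<zero>\<^bsub>R\<^esub>)"
  "p \<oplus>\<^bsub>free_algebra R S\<^esub> q = (\<lambda>w. p w \<oplus>\<^bsub>R\<^esub> q w)"
  "r \<odot>\<^bsub>free_algebra R S\<^esub> p = (\<lambda>w. r \<otimes>\<^bsub>R\<^esub> p w)"
  by (auto simp: free_algebra_def monomial_def)

text \<open>The operations of \<open>free_algebra\<close> do not mention the letters, so a smaller
  alphabet gives a subalgebra cut out by a condition on words alone. This is what links
  \<open>gca_span\<close> to polynomials with letters in W.\<close>

lemma free_algebra_mono:
  assumes "S \<subseteq> T"
  shows "carrier (free_algebra R S) = {p \<in> carrier (free_algebra R T). \<forall>w. p w \<noteq> \<zero>\<^bsub>R\<^esub> \<longrightarrow> set w \<subseteq> S}"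
  unfolding free_algebra_def using assms by force

context cring
begin

lemma monomial_closed [simp]:
  assumes "r \<in> carrier R" "set w \<subseteq> S"
  shows "monomial R r w \<in> carrier (free_algebra R S)"
proof -
  have "{u. monomial R r w u \<noteq> \<zero>} \<subseteq> {w}" by (auto simp: monomial_def)
  then show ?thesis
    using assms finite_subset by (auto simp: free_algebra_simps monomial_def)
qed

lemma free_algebra_add_closed:
  assumes "p \<in> carrier (free_algebra R S)" "q \<in> carrier (free_algebra R S)"
  shows "p \<oplus>\<^bsub>free_algebra R S\<^esub> q \<in> carrier (free_algebra R S)"
proof -
  have "{w. p w \<oplus> q w \<noteq> \<zero>} \<subseteq> {w. p w \<noteq> \<zero>} \<union> {w. q w \<noteq> \<zero>}" by auto
  then have "finite {w. p w \<oplus> q w \<noteq> \<zero>}"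
    by (rule finite_subset) (use assms in \<open>auto simp: free_algebra_simps\<close>)
  moreover have "set w \<subseteq> S" if "p w \<oplus> q w \<noteq> \<zero>" for w
  proof (cases "p w = \<zero>")
    case True
    then have "q w \<noteq> \<zero>" using that by auto
    then show ?thesis using assms(2) unfolding free_algebra_simps by blast
  qed (use assms(1) in \<open>auto simp: free_algebra_simps\<close>)
  ultimately show ?thesis
    using assms unfolding free_algebra_simps by blast
qed

text \<open>Some cut of w must contribute a nonzero term to the convolution. Hence the support of a
  product lies among the concatenations of the two supports, which gives its finiteness.\<close>

lemma free_algebra_mult_nonzero:
  assumes "p \<in> carrier (free_algebra R S)" "q \<in> carrier (free_algebra R S)"
    and "(p \<otimes>\<^bsub>free_algebra R S\<^esub> q) w \<noteq> \<zero>"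
  obtains u v where "w = u @ v" "p u \<noteq> \<zero>" "q v \<noteq> \<zero>"
proof -
  obtain k where k: "p (take k w) \<otimes> q (drop k w) \<noteq> \<zero>"
    using assms(3) add.finprod_one_eqI[of "{..length w}" "\<lambda>k. p (take k w) \<otimes> q (drop k w)"]
    by (auto simp: free_algebra_simps)
  have "p (take k w) \<in> carrier R" "q (drop k w) \<in> carrier R"
    using assms(1,2) by (simp_all add: free_algebra_simps)
  then have "p (take k w) \<noteq> \<zero>" "q (drop k w) \<noteq> \<zero>" using k by auto
  then show thesis by (rule that[OF append_take_drop_id[symmetric]])
qed

lemma free_algebra_mult_closed:
  assumes p: "p \<in> carrier (free_algebra R S)" and q: "q \<in> carrier (free_algebra R S)"
  shows "p \<otimes>\<^bsub>free_algebra R S\<^esub> q \<in> carrier (free_algebra R S)"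
proof -
  let ?m = "p \<otimes>\<^bsub>free_algebra R S\<^esub> q"
  have "{w. ?m w \<noteq> \<zero>} \<subseteq> (\<lambda>(u, v). u @ v) ` ({u. p u \<noteq> \<zero>} \<times> {v. q v \<noteq> \<zero>})"
    by (auto elim!: free_algebra_mult_nonzero[OF p q] simp del: free_algebra_simps intro!: image_eqI)
  moreover have "finite ((\<lambda>(u, v). u @ v) ` ({u. p u \<noteq> \<zero>} \<times> {v. q v \<noteq> \<zero>}))"
    using p q by (auto simp: free_algebra_simps)
  ultimately have "finite {w. ?m w \<noteq> \<zero>}" by (rule finite_subset)
  moreover have "set w \<subseteq> S" if w: "?m w \<noteq> \<zero>" for w
  proof -
    obtain u v where "w = u @ v" "p u \<noteq> \<zero>" "q v \<noteq> \<zero>"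
      by (rule free_algebra_mult_nonzero[OF p q w])
    then show ?thesis using p q by (simp add: free_algebra_simps(1))
  qed
  moreover have "?m w \<in> carrier R" for w
    using p q by (auto simp: free_algebra_simps intro!: finsum_closed)
  ultimately show ?thesis unfolding free_algebra_simps(1) by blast
qed

lemma free_algebra_abelian_group: "abelian_group (free_algebra R S)"
proof (rule abelian_groupI)
  fix p assume p: "p \<in> carrier (free_algebra R S)"
  have "\<ominus> p w \<noteq> \<zero> \<longleftrightarrow> p w \<noteq> \<zero>" for w
    using p by (simp add: free_algebra_simps)
  then have "(\<lambda>w. \<ominus> p w) \<in> carrier (free_algebra R S)"
    using p by (simp add: free_algebra_simps)
  then show "\<exists>q\<in>carrier (free_algebra R S).
      q \<oplus>\<^bsub>free_algebra R S\<^esub> p = \<zero>\<^bsub>free_algebra R S\<^esub>"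
    using p by (intro bexI[of _ "\<lambda>w. \<ominus> p w"]) (auto simp: free_algebra_simps l_neg)
qed (auto simp: free_algebra_add_closed, auto simp: free_algebra_simps a_ac)

text \<open>Words are removed one at a time from a finite set K containing the support. Working with
  a superset makes the removal of a word with coefficient zero harmless.\<close>

lemma free_algebra_induct [consumes 1, case_names zero monomial add]:
  assumes "p \<in> carrier (free_algebra R S)"
    and zero: "P \<zero>\<^bsub>free_algebra R S\<^esub>"
    and monomial: "\<And>r w. r \<in> carrier R \<Longrightarrow> set w \<subseteq> S \<Longrightarrow> P (monomial R r w)"
    and add: "\<And>p q. p \<in> carrier (free_algebra R S) \<Longrightarrow> q \<in> carrier (free_algebra R S) \<Longrightarrow>
        P p \<Longrightarrow> P q \<Longrightarrow> P (p \<oplus>\<^bsub>free_algebra R S\<^esub> q)"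
  shows "P p"
proof -
  have "P p" if "finite K" "{w. p w \<noteq> \<zero>} \<subseteq> K" "p \<in> carrier (free_algebra R S)" for p K
    using that
  proof (induction K arbitrary: p)
    case empty
    then have "p = \<zero>\<^bsub>free_algebra R S\<^esub>" by (auto simp: free_algebra_simps)
    then show ?case using zero by simp
  next
    case (insert w K)
    let ?q = "p(w := \<zero>)"
    have sub: "{u. ?q u \<noteq> \<zero>} \<subseteq> K" using insert.prems by auto
    have q: "?q \<in> carrier (free_algebra R S)"
      using insert.prems(2) finite_subset[OF sub insert.hyps(1)] by (simp add: free_algebra_simps)
    have P1: "P ?q" using insert.IH[OF sub q] .
    show ?case
    proof (cases "p w = \<zero>")
      case True
      then have "?q = p" by auto
      then show ?thesis using P1 by simp
    next
      case False
      then have m: "p w \<in> carrier R" "set w \<subseteq> S" using insert.prems by (auto simp: free_algebra_simps)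
      have "p = monomial R (p w) w \<oplus>\<^bsub>free_algebra R S\<^esub> ?q"
        using insert.prems(2) by (auto simp: free_algebra_simps monomial_def)
      then show ?thesis using add[OF monomial_closed[OF m] q monomial[OF m] P1] by simp
    qed
  qed
  then show ?thesis using assms(1) by (auto simp: free_algebra_simps)
qed

text \<open>In the convolution at w, only the cut at position \<open>length u\<close> can have u as
  its left half.\<close>

lemma monomial_mult:
  assumes "r \<in> carrier R" "s \<in> carrier R"
  shows "monomial R r u \<otimes>\<^bsub>free_algebra R S\<^esub> monomial R s v = monomial R (r \<otimes> s) (u @ v)"
proof
  fix w
  let ?f = "\<lambda>k. monomial R r u (take k w) \<otimes> monomial R s v (drop k w)"
  have c: "?f k \<in> carrier R" for k using assms by (auto simp: monomial_def)
  show "(monomial R r u \<otimes>\<^bsub>free_algebra R S\<^esub> monomial R s v) w = monomial R (r \<otimes> s) (u @ v) w"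
  proof (cases "w = u @ v")
    case True
    have "finsum R ?f {..length w} = finsum R ?f {length u}"
    proof (rule finsum_superset)
      fix k assume k: "k \<in> {..length w} - {length u}"
      then have "take k w \<noteq> u" by auto
      then show "?f k = \<zero>" using assms by (simp add: monomial_def)
    qed (use True c in auto)
    also have "\<dots> = r \<otimes> s" using True assms by (simp add: monomial_def)
    finally show ?thesis using True by (simp add: free_algebra_simps monomial_def)
  next
    case False
    have "?f k = \<zero>" for k
      using False assms append_take_drop_id[of k w] by (auto simp: monomial_def)
    then show ?thesis using False by (simp add: free_algebra_simps monomial_def)
  qed
qed

text \<open>Distributivity and the null laws hold coefficientwise. They reduce associativity and the
  unit laws to monomials, where these become the laws of concatenation and of multiplication in
  R.\<close>

lemma free_algebra_ring: "ring (free_algebra R S)"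
proof -
  let ?F = "free_algebra R S"
  interpret F: abelian_group ?F by (rule free_algebra_abelian_group)
  have l_distr: "(p \<oplus>\<^bsub>?F\<^esub> q) \<otimes>\<^bsub>?F\<^esub> s = p \<otimes>\<^bsub>?F\<^esub> s \<oplus>\<^bsub>?F\<^esub> q \<otimes>\<^bsub>?F\<^esub> s"
    and r_distr: "s \<otimes>\<^bsub>?F\<^esub> (p \<oplus>\<^bsub>?F\<^esub> q) = s \<otimes>\<^bsub>?F\<^esub> p \<oplus>\<^bsub>?F\<^esub> s \<otimes>\<^bsub>?F\<^esub> q"
    if "p \<in> carrier ?F" "q \<in> carrier ?F" "s \<in> carrier ?F" for p q s
    using that by (auto simp: free_algebra_simps l_distr r_distr finsum_addf Pi_def intro!: ext)
  have l_null: "\<zero>\<^bsub>?F\<^esub> \<otimes>\<^bsub>?F\<^esub> s = \<zero>\<^bsub>?F\<^esub>" and r_null: "s \<otimes>\<^bsub>?F\<^esub> \<zero>\<^bsub>?F\<^esub> = \<zero>\<^bsub>?F\<^esub>"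
    if "s \<in> carrier ?F" for s
    using that by (auto simp: free_algebra_simps intro!: ext)
  note closed = free_algebra_mult_closed[where S = S]
  have assoc: "(p \<otimes>\<^bsub>?F\<^esub> q) \<otimes>\<^bsub>?F\<^esub> s = p \<otimes>\<^bsub>?F\<^esub> (q \<otimes>\<^bsub>?F\<^esub> s)"
    if p: "p \<in> carrier ?F" and q: "q \<in> carrier ?F" and s: "s \<in> carrier ?F" for p q s
    using p
  proof (induction rule: free_algebra_induct)
    case (monomial a u)
    show ?case using q
    proof (induction rule: free_algebra_induct)
      case (monomial b v)
      show ?case using s
      proof (induction rule: free_algebra_induct)
        case (monomial c w)
        then show ?case
          using \<open>a \<in> carrier R\<close> \<open>b \<in> carrier R\<close> by (simp add: monomial_mult m_assoc)
      next
        case zero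
        show ?case using \<open>a \<in> carrier R\<close> \<open>b \<in> carrier R\<close> \<open>set u \<subseteq> S\<close> \<open>set v \<subseteq> S\<close>
          by (simp add: r_null closed)
      next
        case (add s s')
        then show ?case using \<open>a \<in> carrier R\<close> \<open>b \<in> carrier R\<close> \<open>set u \<subseteq> S\<close> \<open>set v \<subseteq> S\<close>
          by (simp add: r_distr closed)
      qed
    next
      case zero
      show ?case using \<open>a \<in> carrier R\<close> \<open>set u \<subseteq> S\<close> s by (simp add: r_null l_null closed)
    next
      case (add q q')
      then show ?case using \<open>a \<in> carrier R\<close> \<open>set u \<subseteq> S\<close> s by (simp add: r_distr l_distr closed)
    qed
  next
    case zero
    show ?case using q s by (simp add: l_null closed)
  next
    case (add p p')
    then show ?case using q s by (simp add: l_distr closed)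
  qed
  have one: "\<one>\<^bsub>?F\<^esub> \<in> carrier ?F" unfolding free_algebra_simps(3) by (rule monomial_closed) auto
  have l_one: "\<one>\<^bsub>?F\<^esub> \<otimes>\<^bsub>?F\<^esub> p = p" if "p \<in> carrier ?F" for p
    using that
  proof (induction rule: free_algebra_induct)
    case (monomial r w)
    then show ?case by (simp add: free_algebra_simps(3) monomial_mult)
  qed (simp_all add: r_null r_distr one)
  have r_one: "p \<otimes>\<^bsub>?F\<^esub> \<one>\<^bsub>?F\<^esub> = p" if "p \<in> carrier ?F" for p
    using that
  proof (induction rule: free_algebra_induct)
    case (monomial r w)
    then show ?case by (simp add: free_algebra_simps(3) monomial_mult)
  qed (simp_all add: l_null l_distr one)
  show ?thesis
    by (intro ringI monoidI F.abelian_group_axioms) (simp_all add: closed one assoc l_one r_one l_distr r_distr)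
qed

text \<open>Scalars act as constant polynomials. Closure under scalars, both of the algebra and of
  its ideals, and the compatibility of evaluation with scalars thereby become statements about
  products.\<close>

lemma monomial_smult:
  assumes "r \<in> carrier R" "p \<in> carrier (free_algebra R S)"
  shows "r \<odot>\<^bsub>free_algebra R S\<^esub> p = monomial R r [] \<otimes>\<^bsub>free_algebra R S\<^esub> p"
  using assms(2)
proof (induction rule: free_algebra_induct)
  case zero
  interpret F: ring "free_algebra R S" by (rule free_algebra_ring)
  show ?case using assms(1) by simp (simp add: free_algebra_simps)
next
  case (monomial s w)
  then show ?case using assms(1) by (auto simp: monomial_mult, auto simp: free_algebra_simps monomial_def)
next
  case (add p q)
  interpret F: ring "free_algebra R S" by (rule free_algebra_ring)
  have "r \<odot>\<^bsub>free_algebra R S\<^esub> (p \<oplus>\<^bsub>free_algebra R S\<^esub> q) =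
      r \<odot>\<^bsub>free_algebra R S\<^esub> p \<oplus>\<^bsub>free_algebra R S\<^esub> r \<odot>\<^bsub>free_algebra R S\<^esub> q"
    using add.hyps assms(1) by (auto simp: free_algebra_simps r_distr)
  then show ?case using add assms(1) by (simp add: F.r_distr)
qed

lemma free_algebra_smult_closed:
  assumes "r \<in> carrier R" "p \<in> carrier (free_algebra R S)"
  shows "r \<odot>\<^bsub>free_algebra R S\<^esub> p \<in> carrier (free_algebra R S)"
  using assms by (simp add: monomial_smult free_algebra_mult_closed)

lemma letter_closed: "v \<in> S \<Longrightarrow> letter R v \<in> carrier (free_algebra R S)"
  by (simp add: letter_eq_monomial)

end

section \<open>Evaluation of noncommutative polynomials\<close>

definition word_prod :: "('r, 'a) grmod \<Rightarrow> ('s \<Rightarrow> 'a) \<Rightarrow> 's list \<Rightarrow> 'a" where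
  "word_prod A f w = foldr (\<lambda>v y. f v \<otimes>\<^bsub>A\<^esub> y) w \<one>\<^bsub>A\<^esub>"

definition free_eval ::
  "('r, 'm) ring_scheme \<Rightarrow> ('r, 'a) grmod \<Rightarrow> ('s \<Rightarrow> 'a) \<Rightarrow> ('s list \<Rightarrow> 'r) \<Rightarrow> 'a" where
  "free_eval R A f p = finsum A (\<lambda>w. p w \<odot>\<^bsub>A\<^esub> word_prod A f w) {w. p w \<noteq> \<zero>\<^bsub>R\<^esub>}"

lemma word_prod_simps [simp]:
  "word_prod A f [] = \<one>\<^bsub>A\<^esub>"
  "word_prod A f (v # w) = f v \<otimes>\<^bsub>A\<^esub> word_prod A f w"
  by (simp_all add: word_prod_def)

lemma word_prod_cong: "(\<And>v. v \<in> set w \<Longrightarrow> f v = g v) \<Longrightarrow> word_prod A f w = word_prod A g w"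
  by (induction w) auto

context graded_comm_algebra
begin

lemma word_prod_closed: "f \<in> S \<rightarrow> carrier A \<Longrightarrow> set w \<subseteq> S \<Longrightarrow> word_prod A f w \<in> carrier A"
  by (induction w) auto

lemma word_prod_append:
  "f \<in> S \<rightarrow> carrier A \<Longrightarrow> set u \<subseteq> S \<Longrightarrow> set w \<subseteq> S \<Longrightarrow>
    word_prod A f (u @ w) = word_prod A f u \<otimes>\<^bsub>A\<^esub> word_prod A f w"
  by (induction u) (auto simp: word_prod_closed m_assoc Pi_def)

lemma word_prod_homog:
  assumes "\<And>v i. v \<in> homog V i \<Longrightarrow> f v \<in> homog A i" "word_of_degree V n w"
  shows "word_prod A f w \<in> homog A n"
proof -
  obtain ks where "list_all2 (\<lambda>v k. v \<in> homog V k) w ks" "sum_list ks = n"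
    using assms(2) unfolding word_of_degree_def by blast
  then show ?thesis
    by (induction arbitrary: n rule: list_all2_induct) (auto intro: one_homog mult_homog assms(1))
qed

context
  fixes f :: "'s \<Rightarrow> 'a" and S :: "'s set"
  assumes f: "f \<in> S \<rightarrow> carrier A"
begin

lemma free_eval_term_closed:
  assumes "p \<in> carrier (free_algebra R S)" "p w \<noteq> \<zero>"
  shows "p w \<odot>\<^bsub>A\<^esub> word_prod A f w \<in> carrier A"
  using assms word_prod_closed[OF f] by (simp add: free_algebra_simps)

lemma free_eval_superset:
  assumes "p \<in> carrier (free_algebra R S)" "finite K" "{w. p w \<noteq> \<zero>} \<subseteq> K"
    and "\<And>w. w \<in> K \<Longrightarrow> set w \<subseteq> S"
  shows "free_eval R A f p = finsum A (\<lambda>w. p w \<odot>\<^bsub>A\<^esub> word_prod A f w) K"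
  unfolding free_eval_def
  by (rule M.finsum_superset[symmetric])
     (use assms word_prod_closed[OF f] in \<open>auto simp: free_algebra_simps\<close>)

lemma free_eval_closed:
  assumes "p \<in> carrier (free_algebra R S)"
  shows "free_eval R A f p \<in> carrier A"
  unfolding free_eval_def using free_eval_term_closed[OF assms] by (intro M.finsum_closed) auto

lemma free_eval_add:
  assumes p: "p \<in> carrier (free_algebra R S)" and q: "q \<in> carrier (free_algebra R S)"
  shows "free_eval R A f (p \<oplus>\<^bsub>free_algebra R S\<^esub> q) = free_eval R A f p \<oplus>\<^bsub>A\<^esub> free_eval R A f q"
proof -
  let ?K = "{w. p w \<noteq> \<zero>} \<union> {w. q w \<noteq> \<zero>}"
  have K: "finite ?K" "\<And>w. w \<in> ?K \<Longrightarrow> set w \<subseteq> S"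
    using p q by (auto simp: free_algebra_simps)
  have pq: "p w \<in> carrier R" "q w \<in> carrier R" for w using p q by (auto simp: free_algebra_simps)
  have "free_eval R A f (p \<oplus>\<^bsub>free_algebra R S\<^esub> q) =
      (\<Oplus>\<^bsub>A\<^esub>w\<in>?K. (p \<oplus>\<^bsub>free_algebra R S\<^esub> q) w \<odot>\<^bsub>A\<^esub> word_prod A f w)"
    by (rule free_eval_superset)
       (use K R.free_algebra_add_closed[OF p q] pq in \<open>auto simp: free_algebra_simps(5)\<close>)
  also have "\<dots> = (\<Oplus>\<^bsub>A\<^esub>w\<in>?K. p w \<odot>\<^bsub>A\<^esub> word_prod A f w \<oplus>\<^bsub>A\<^esub> q w \<odot>\<^bsub>A\<^esub> word_prod A f w)"
    using pq K(2) word_prod_closed[OF f]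
    by (intro M.finsum_cong') (auto simp: free_algebra_simps(5) smult_l_distr)
  also have "\<dots> = (\<Oplus>\<^bsub>A\<^esub>w\<in>?K. p w \<odot>\<^bsub>A\<^esub> word_prod A f w) \<oplus>\<^bsub>A\<^esub> (\<Oplus>\<^bsub>A\<^esub>w\<in>?K. q w \<odot>\<^bsub>A\<^esub> word_prod A f w)"
    using pq K(2) word_prod_closed[OF f] by (intro M.finsum_addf) auto
  also have "\<dots> = free_eval R A f p \<oplus>\<^bsub>A\<^esub> free_eval R A f q"
    using free_eval_superset[OF p K(1) _ K(2)] free_eval_superset[OF q K(1) _ K(2)] by simp
  finally show ?thesis .
qed

lemma free_eval_monomial:
  assumes "r \<in> carrier R" "set w \<subseteq> S"
  shows "free_eval R A f (monomial R r w) = r \<odot>\<^bsub>A\<^esub> word_prod A f w"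
proof -
  have "free_eval R A f (monomial R r w) =
      finsum A (\<lambda>u. monomial R r w u \<odot>\<^bsub>A\<^esub> word_prod A f u) {w}"
    by (rule free_eval_superset) (use assms in \<open>auto simp: monomial_def R.monomial_closed\<close>)
  also have "\<dots> = r \<odot>\<^bsub>A\<^esub> word_prod A f w"
    using assms word_prod_closed[OF f] by (simp add: monomial_def)
  finally show ?thesis .
qed

lemma free_eval_zero: "free_eval R A f \<zero>\<^bsub>free_algebra R S\<^esub> = \<zero>\<^bsub>A\<^esub>"
  by (simp add: free_eval_def free_algebra_simps(4))

lemma free_eval_one: "free_eval R A f \<one>\<^bsub>free_algebra R S\<^esub> = \<one>\<^bsub>A\<^esub>"
  by (simp add: free_algebra_simps(3) free_eval_monomial)

lemma free_eval_letter: "v \<in> S \<Longrightarrow> free_eval R A f (letter R v) = f v"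
  using f by (simp add: letter_eq_monomial free_eval_monomial Pi_def)

text \<open>Both sides are additive in each argument, so monomials suffice; there the words
  concatenate and the coefficients are pulled out by \<open>smult_mult_left\<close> and
  \<open>smult_mult_right\<close>.\<close>

lemma free_eval_mult:
  assumes p: "p \<in> carrier (free_algebra R S)" and q: "q \<in> carrier (free_algebra R S)"
  shows "free_eval R A f (p \<otimes>\<^bsub>free_algebra R S\<^esub> q) = free_eval R A f p \<otimes>\<^bsub>A\<^esub> free_eval R A f q"
proof -
  interpret F: ring "free_algebra R S" by (rule R.free_algebra_ring)
  show ?thesis using p
  proof (induction rule: R.free_algebra_induct)
    case (monomial r u)
    show ?case using q
    proof (induction rule: R.free_algebra_induct)
      case (monomial s w)
      have "(r \<odot>\<^bsub>A\<^esub> x) \<otimes>\<^bsub>A\<^esub> (s \<odot>\<^bsub>A\<^esub> y) = (r \<otimes> s) \<odot>\<^bsub>A\<^esub> (x \<otimes>\<^bsub>A\<^esub> y)"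
        if "x \<in> carrier A" "y \<in> carrier A" for x y
        using that \<open>r \<in> carrier R\<close> \<open>s \<in> carrier R\<close>
        by (subst smult_mult_left) (simp_all add: smult_mult_right smult_assoc1)
      then show ?case
        using monomial \<open>r \<in> carrier R\<close> \<open>set u \<subseteq> S\<close> word_prod_closed[OF f]
        by (simp add: R.monomial_mult free_eval_monomial word_prod_append[OF f])
    qed (use \<open>r \<in> carrier R\<close> \<open>set u \<subseteq> S\<close> in
          \<open>simp_all add: free_eval_zero free_eval_add free_eval_closed F.r_distr r_distr\<close>)
  qed (use q in \<open>simp_all add: free_eval_zero free_eval_add free_eval_closed F.l_distr l_distr\<close>)
qed

lemma free_eval_smult:
  assumes "r \<in> carrier R" and p: "p \<in> carrier (free_algebra R S)"
  shows "free_eval R A f (r \<odot>\<^bsub>free_algebra R S\<^esub> p) = r \<odot>\<^bsub>A\<^esub> free_eval R A f p"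
  using assms
  by (simp add: R.monomial_smult free_eval_mult free_eval_monomial smult_mult_left free_eval_closed)

lemma free_eval_ring_hom: "free_eval R A f \<in> ring_hom (free_algebra R S) A"
  by (intro ring_hom_memI) (simp_all add: free_eval_closed free_eval_add free_eval_mult free_eval_one)

lemma free_eval_homog:
  assumes "\<And>v i. v \<in> homog V i \<Longrightarrow> f v \<in> homog A i"
    and p: "p \<in> carrier (free_algebra R S)" "\<And>w. p w \<noteq> \<zero> \<Longrightarrow> word_of_degree V n w"
  shows "free_eval R A f p \<in> homog A n"
proof -
  \<comment> \<open>The induction runs over subsets of the support, since only words occurring in p
    are known to have degree n.\<close>
  have "finsum A (\<lambda>w. p w \<odot>\<^bsub>A\<^esub> word_prod A f w) K \<in> homog A n"
    if "finite K" "K \<subseteq> {w. p w \<noteq> \<zero>}" for K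
    using that
  proof (induction K)
    case empty
    then show ?case by simp
  next
    case (insert w K)
    have "p w \<odot>\<^bsub>A\<^esub> word_prod A f w \<in> homog A n"
    proof (rule homog_smult)
      show "word_prod A f w \<in> homog A n"
        using insert.prems by (intro word_prod_homog[where V = V] assms(1) p(2)) auto
    qed (use p(1) in \<open>simp add: free_algebra_simps\<close>)
    moreover have "(\<Oplus>\<^bsub>A\<^esub>w\<in>insert w K. p w \<odot>\<^bsub>A\<^esub> word_prod A f w) =
        p w \<odot>\<^bsub>A\<^esub> word_prod A f w \<oplus>\<^bsub>A\<^esub> (\<Oplus>\<^bsub>A\<^esub>w\<in>K. p w \<odot>\<^bsub>A\<^esub> word_prod A f w)"
      using insert free_eval_term_closed[OF p(1)] by (intro M.finsum_insert) auto
    ultimately show ?case using insert homog_add by simp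
  qed
  then show ?thesis
    unfolding free_eval_def using p(1) by (auto simp: free_algebra_simps)
qed

end

lemma free_eval_cong:
  assumes "p \<in> carrier (free_algebra R S)" "f \<in> T \<rightarrow> carrier A" "S \<subseteq> T" "\<And>v. v \<in> S \<Longrightarrow> f v = g v"
  shows "free_eval R A f p = free_eval R A g p"
  unfolding free_eval_def
proof (rule M.finsum_cong')
  fix w assume "w \<in> {w. p w \<noteq> \<zero>}"
  then have "set w \<subseteq> S" using assms(1) by (simp add: free_algebra_simps)
  then show "p w \<odot>\<^bsub>A\<^esub> word_prod A f w = p w \<odot>\<^bsub>A\<^esub> word_prod A g w"
    using assms(4) word_prod_cong[of w f g A] by (simp add: subset_iff)
next
  have "g v \<in> carrier A" if "v \<in> S" for v
    using assms(2,3) assms(4)[OF that, symmetric] that by auto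
  then show "(\<lambda>w. p w \<odot>\<^bsub>A\<^esub> word_prod A g w) \<in> {w. p w \<noteq> \<zero>} \<rightarrow> carrier A"
    using free_eval_term_closed[OF _ assms(1)] by auto
qed simp

end

section \<open>The universal property of the free graded commutative algebra\<close>

text \<open>The function is total on the type and constrained only on W, so one and the same
  function can serve at several stages of a filtration and restriction needs no new object.\<close>

definition graded_linear_on ::
  "('r, 'm) ring_scheme \<Rightarrow> ('r, 'v) grmod \<Rightarrow> 'v set \<Rightarrow> ('r, 'a) grmod \<Rightarrow> ('v \<Rightarrow> 'a) \<Rightarrow> bool" where
  "graded_linear_on R V W A f \<longleftrightarrow>
     linear_map R (V\<lparr>carrier := W\<rparr>) A f \<and> (\<forall>i. f ` (homog V i \<inter> W) \<subseteq> homog A i)"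

lemma
  assumes "graded_linear_on R V W A f"
  shows graded_linear_on_closed: "x \<in> W \<Longrightarrow> f x \<in> carrier A"
    and graded_linear_on_add: "x \<in> W \<Longrightarrow> y \<in> W \<Longrightarrow> f (x \<oplus>\<^bsub>V\<^esub> y) = f x \<oplus>\<^bsub>A\<^esub> f y"
    and graded_linear_on_smult: "r \<in> carrier R \<Longrightarrow> x \<in> W \<Longrightarrow> f (r \<odot>\<^bsub>V\<^esub> x) = r \<odot>\<^bsub>A\<^esub> f x"
    and graded_linear_on_homog: "x \<in> homog V i \<Longrightarrow> x \<in> W \<Longrightarrow> f x \<in> homog A i"
  using assms unfolding graded_linear_on_def linear_map_def by fastforce+

lemma graded_linear_onI:
  assumes "\<And>x. x \<in> W \<Longrightarrow> f x \<in> carrier A"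
    and "\<And>x y. x \<in> W \<Longrightarrow> y \<in> W \<Longrightarrow> f (x \<oplus>\<^bsub>V\<^esub> y) = f x \<oplus>\<^bsub>A\<^esub> f y"
    and "\<And>r x. r \<in> carrier R \<Longrightarrow> x \<in> W \<Longrightarrow> f (r \<odot>\<^bsub>V\<^esub> x) = r \<odot>\<^bsub>A\<^esub> f x"
    and "\<And>i x. x \<in> homog V i \<Longrightarrow> x \<in> W \<Longrightarrow> f x \<in> homog A i"
  shows "graded_linear_on R V W A f"
  using assms unfolding graded_linear_on_def linear_map_def by auto

abbreviation grade_sub :: "('r, 'v) grmod \<Rightarrow> 'v set \<Rightarrow> ('r, 'v) grmod" where
  "grade_sub V W \<equiv> V\<lparr>carrier := W, homog := \<lambda>i. homog V i \<inter> W\<rparr>"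

text \<open>An element of \<Lambda>V is a coset of polynomials. If f respects the relations,
  evaluation is constant on each coset, so the image is a singleton and \<open>the_elem\<close>
  reads off its value.\<close>

definition gca_lift ::
  "('r, 'm) ring_scheme \<Rightarrow> ('r, 'a) grmod \<Rightarrow> ('v \<Rightarrow> 'a) \<Rightarrow> ('v list \<Rightarrow> 'r) set \<Rightarrow> 'a" where
  "gca_lift R A f C = the_elem (free_eval R A f ` C)"

text \<open>The algebra axioms for \<Lambda>V come with the given cdga structure on it; what has to
  be derived here is how its operations act on representatives.\<close>

locale free_gca_algebra =
  V: graded_module R V + L: graded_comm_algebra R "free_gca R V"
  for R :: "('r, 'm) ring_scheme" (structure) and V :: "('r, 'v) grmod"
begin

abbreviation "F \<equiv> free_algebra R (carrier V)"
abbreviation "\<Lambda>V \<equiv> free_gca R V"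

sublocale F: ring F
  by (rule V.R.free_algebra_ring)

lemma signed_closed: "p \<in> carrier F \<Longrightarrow> signed F k p \<in> carrier F"
  by (simp add: signed_def)

lemma gca_relations_closed: "gca_relations R V \<subseteq> carrier F"
  unfolding gca_relations_def Let_def
  using V.homog_carrier
  by (auto intro!: F.minus_closed F.a_closed F.m_closed signed_closed V.R.letter_closed
      V.R.free_algebra_smult_closed)

sublocale I: ideal "gca_ideal R V" F
  unfolding gca_ideal_def by (rule F.genideal_ideal[OF gca_relations_closed])

lemma gca_relations_ideal: "gca_relations R V \<subseteq> gca_ideal R V"
  unfolding gca_ideal_def by (rule F.genideal_self[OF gca_relations_closed])

lemma gca_class_eqI:
  assumes "p \<ominus>\<^bsub>F\<^esub> q \<in> gca_ideal R V" "p \<in> carrier F" "q \<in> carrier F"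
  shows "gca_class R V p = gca_class R V q"
  unfolding gca_class_def
  using F.quotient_eq_iff_same_a_r_cos[OF I.is_ideal assms(2,3)] assms(1) by blast

lemma gca_carrier: "carrier \<Lambda>V = gca_class R V ` carrier F"
  by (auto simp: free_gca_def Let_def FactRing_def A_RCOSETS_def' gca_class_def)

lemma gca_class_closed: "p \<in> carrier F \<Longrightarrow> gca_class R V p \<in> carrier \<Lambda>V"
  by (simp add: gca_carrier)

lemma gca_class_add:
  "p \<in> carrier F \<Longrightarrow> q \<in> carrier F \<Longrightarrow>
    gca_class R V p \<oplus>\<^bsub>\<Lambda>V\<^esub> gca_class R V q = gca_class R V (p \<oplus>\<^bsub>F\<^esub> q)"
  by (simp add: free_gca_def Let_def FactRing_def gca_class_def I.a_rcos_sum)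

lemma gca_class_mult:
  "p \<in> carrier F \<Longrightarrow> q \<in> carrier F \<Longrightarrow>
    gca_class R V p \<otimes>\<^bsub>\<Lambda>V\<^esub> gca_class R V q = gca_class R V (p \<otimes>\<^bsub>F\<^esub> q)"
  by (simp add: free_gca_def Let_def FactRing_def gca_class_def I.rcoset_mult_add)

lemma gca_class_one: "\<one>\<^bsub>\<Lambda>V\<^esub> = gca_class R V \<one>\<^bsub>F\<^esub>"
  by (simp add: free_gca_def Let_def FactRing_def gca_class_def)

lemma gca_class_zero: "\<zero>\<^bsub>\<Lambda>V\<^esub> = gca_class R V \<zero>\<^bsub>F\<^esub>"
  by (simp add: free_gca_def Let_def FactRing_def gca_class_def I.a_rcos_const)

text \<open>The scalar action on cosets is defined as a union over all representatives, so it must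
  be shown that they all yield the same coset. Two representatives differ by some h in the ideal,
  and their multiples differ by the constant r times h, again in the ideal.\<close>

lemma gca_class_smult:
  assumes r: "r \<in> carrier R" and p: "p \<in> carrier F"
  shows "r \<odot>\<^bsub>\<Lambda>V\<^esub> gca_class R V p = gca_class R V (r \<odot>\<^bsub>F\<^esub> p)"
proof -
  have "gca_class R V (r \<odot>\<^bsub>F\<^esub> q) = gca_class R V (r \<odot>\<^bsub>F\<^esub> p)" if q: "q \<in> gca_class R V p" for q
  proof -
    obtain h where h: "h \<in> gca_ideal R V" "q = h \<oplus>\<^bsub>F\<^esub> p"
      using q unfolding gca_class_def a_r_coset_def' by blast
    have hF: "h \<in> carrier F" using h(1) I.Icarr by blast
    have m: "monomial R r [] \<in> carrier F" using r by simp
    have "r \<odot>\<^bsub>F\<^esub> q \<ominus>\<^bsub>F\<^esub> r \<odot>\<^bsub>F\<^esub> p = monomial R r [] \<otimes>\<^bsub>F\<^esub> h"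
      using r p hF m h(2)
      by (simp add: V.R.monomial_smult F.r_distr F.minus_eq F.a_assoc F.r_neg)
    also have "\<dots> \<in> gca_ideal R V" using h(1) m by (rule I.I_l_closed)
    finally show ?thesis
      using r p hF h(2) by (intro gca_class_eqI) (simp_all add: V.R.free_algebra_smult_closed)
  qed
  moreover have "p \<in> gca_class R V p"
    unfolding gca_class_def using p by (rule I.a_rcos_self)
  moreover have "r \<odot>\<^bsub>\<Lambda>V\<^esub> gca_class R V p = (\<Union>q\<in>gca_class R V p. gca_class R V (r \<odot>\<^bsub>F\<^esub> q))"
    by (simp add: free_gca_def Let_def)
  ultimately show ?thesis by blast
qed

lemma gca_incl_closed: "v \<in> carrier V \<Longrightarrow> gca_incl R V v \<in> carrier \<Lambda>V"
  unfolding gca_incl_def by (intro gca_class_closed V.R.letter_closed)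

lemma gca_incl_add:
  assumes "v \<in> carrier V" "w \<in> carrier V"
  shows "gca_incl R V (v \<oplus>\<^bsub>V\<^esub> w) = gca_incl R V v \<oplus>\<^bsub>\<Lambda>V\<^esub> gca_incl R V w"
proof -
  have "letter R (v \<oplus>\<^bsub>V\<^esub> w) \<ominus>\<^bsub>F\<^esub> (letter R v \<oplus>\<^bsub>F\<^esub> letter R w) \<in> gca_ideal R V"
    using gca_relations_ideal assms unfolding gca_relations_def Let_def by blast
  from gca_class_eqI[OF this] show ?thesis
    unfolding gca_incl_def using assms by (simp add: gca_class_add V.R.letter_closed)
qed

lemma gca_incl_smult:
  assumes "r \<in> carrier R" "v \<in> carrier V"
  shows "gca_incl R V (r \<odot>\<^bsub>V\<^esub> v) = r \<odot>\<^bsub>\<Lambda>V\<^esub> gca_incl R V v"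
proof -
  have "letter R (r \<odot>\<^bsub>V\<^esub> v) \<ominus>\<^bsub>F\<^esub> (r \<odot>\<^bsub>F\<^esub> letter R v) \<in> gca_ideal R V"
    using gca_relations_ideal assms unfolding gca_relations_def Let_def by blast
  from gca_class_eqI[OF this] show ?thesis
    unfolding gca_incl_def using assms
    by (simp add: gca_class_smult V.R.letter_closed V.R.free_algebra_smult_closed)
qed

lemma gca_incl_homog:
  assumes "v \<in> homog V i"
  shows "gca_incl R V v \<in> homog \<Lambda>V i"
proof -
  have "word_of_degree V i [v]"
    unfolding word_of_degree_def using assms by (intro exI[of _ "[i]"]) simp
  moreover have "letter R v \<in> carrier F"
    using V.homog_carrier[OF assms] by (rule V.R.letter_closed)
  ultimately show ?thesis
    unfolding gca_incl_def by (auto simp: free_gca_def Let_def gca_span_def letter_def intro!: imageI)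
qed

lemma sub_gca_eq:
  assumes "W \<subseteq> carrier V"
  shows "sub_gca R V W = gca_class R V ` carrier (free_algebra R W)"
  unfolding sub_gca_def gca_span_def free_algebra_mono[OF assms] ..

lemma sub_gca_carrier: "sub_gca R V (carrier V) = carrier \<Lambda>V"
  by (simp add: sub_gca_eq gca_carrier)

text \<open>Words with letters in W span the image of \<Lambda>W, and a word is built by multiplying
  letters on the left. The left factor may be taken homogeneous, as the Leibniz rule requires in
  order to have a definite sign.\<close>

lemma sub_gca_induct [consumes 3, case_names zero one add smult incl_mult]:
  assumes x: "x \<in> sub_gca R V W"
    and W: "W \<subseteq> carrier V" "graded_module R (grade_sub V W)"
    and zero: "P \<zero>\<^bsub>\<Lambda>V\<^esub>" and one: "P \<one>\<^bsub>\<Lambda>V\<^esub>"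
    and add: "\<And>x y. x \<in> carrier \<Lambda>V \<Longrightarrow> y \<in> carrier \<Lambda>V \<Longrightarrow> P x \<Longrightarrow> P y \<Longrightarrow> P (x \<oplus>\<^bsub>\<Lambda>V\<^esub> y)"
    and smult: "\<And>r x. r \<in> carrier R \<Longrightarrow> x \<in> carrier \<Lambda>V \<Longrightarrow> P x \<Longrightarrow> P (r \<odot>\<^bsub>\<Lambda>V\<^esub> x)"
    and incl_mult: "\<And>v i x. v \<in> W \<Longrightarrow> v \<in> homog V i \<Longrightarrow> x \<in> carrier \<Lambda>V \<Longrightarrow> P x \<Longrightarrow>
      P (gca_incl R V v \<otimes>\<^bsub>\<Lambda>V\<^esub> x)"
  shows "P x"
proof -
  interpret W: graded_module R "grade_sub V W" by fact
  have sub: "p \<in> carrier F" if "p \<in> carrier (free_algebra R W)" for p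
    using that by (simp add: free_algebra_mono[OF W(1)])
  \<comment> \<open>W is graded in its own right, so an arbitrary letter from W is a sum of
    homogeneous letters that still lie in W.\<close>
  have incl_mult': "P (gca_incl R V v \<otimes>\<^bsub>\<Lambda>V\<^esub> x)" if "v \<in> W" "x \<in> carrier \<Lambda>V" "P x" for v x
  proof -
    have "v \<in> carrier (grade_sub V W)" using that by simp
    then show ?thesis
    proof (induction rule: W.homog_induct)
      case (homog i v)
      then show ?case using that(2,3) by (auto intro: incl_mult)
    next
      case (add v w)
      then show ?case
        using that W(1) assms(6)
        by (simp add: gca_incl_add subset_iff L.l_distr gca_incl_closed)
    qed
  qed
  have word: "P (gca_class R V (monomial R \<one> w))" if "set w \<subseteq> W" for w
    using that
  proof (induction w)
    case Nil
    then show ?case using one by (simp add: gca_class_one free_algebra_simps(3))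
  next
    case (Cons v w)
    have m: "monomial R \<one> w \<in> carrier F" using Cons.prems W(1) by (intro V.R.monomial_closed) auto
    have l: "letter R v \<in> carrier F" using Cons.prems W(1) by (intro V.R.letter_closed) auto
    have "gca_incl R V v \<otimes>\<^bsub>\<Lambda>V\<^esub> gca_class R V (monomial R \<one> w) = gca_class R V (monomial R \<one> (v # w))"
      unfolding gca_incl_def using gca_class_mult[OF l m]
      by (simp add: letter_eq_monomial V.R.monomial_mult)
    then show ?case
      using incl_mult'[of v "gca_class R V (monomial R \<one> w)"] Cons gca_class_closed[OF m] by simp
  qed
  obtain p where p: "p \<in> carrier (free_algebra R W)" "x = gca_class R V p"
    using x sub_gca_eq[OF W(1)] by blast
  have "P (gca_class R V p)" using p(1)
  proof (induction rule: V.R.free_algebra_induct)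
    case zero
    then show ?case using assms(4) by (simp add: gca_class_zero free_algebra_simps(4))
  next
    case (monomial r w)
    have m: "monomial R \<one> w \<in> carrier F"
      using monomial W(1) by (intro V.R.monomial_closed) auto
    have "r \<odot>\<^bsub>\<Lambda>V\<^esub> gca_class R V (monomial R \<one> w) = gca_class R V (monomial R r w)"
      using gca_class_smult[OF monomial(1) m] monomial(1)
      by (simp add: V.R.monomial_smult[OF monomial(1) m] V.R.monomial_mult)
    then show ?case
      using smult[OF monomial(1) gca_class_closed[OF m] word[OF monomial(2)]] by simp
  next
    case (add p q)
    then show ?case
      using assms(6)[OF gca_class_closed[OF sub] gca_class_closed[OF sub], of p q]
      by (simp add: gca_class_add sub) (simp add: free_algebra_simps(5))
  qed
  then show ?thesis using p by simp
qed

end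

section \<open>The homomorphism induced by a graded linear map\<close>

locale free_gca_lift = free_gca_algebra R V + A: graded_comm_algebra R A
  for R :: "('r, 'm) ring_scheme" (structure) and V :: "('r, 'v) grmod"
    and A :: "('r, 'a) grmod" and f :: "'v \<Rightarrow> 'a" +
  assumes linear: "graded_linear_on R V (carrier V) A f"
begin

lemma fun_closed: "f \<in> carrier V \<rightarrow> carrier A"
  using graded_linear_on_closed[OF linear] by blast

sublocale E: ring_hom_ring F A "free_eval R A f"
  using F.ring_axioms A.ring_axioms A.free_eval_ring_hom[OF fun_closed] by (rule ring_hom_ringI2)

lemma free_eval_signed:
  "p \<in> carrier F \<Longrightarrow> free_eval R A f (signed F k p) = signed A k (free_eval R A f p)"
  by (simp add: signed_def)

text \<open>Linearity of f disposes of the first two families. The third needs f to preserve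
  degrees, so that graded commutativity of A produces the same sign as in the relation.\<close>

lemma free_eval_relations:
  assumes "p \<in> gca_relations R V"
  shows "free_eval R A f p = \<zero>\<^bsub>A\<^esub>"
proof -
  have eq: "free_eval R A f (p \<ominus>\<^bsub>F\<^esub> q) = \<zero>\<^bsub>A\<^esub>"
    if "p \<in> carrier F" "q \<in> carrier F" "free_eval R A f p = free_eval R A f q" for p q
    using that E.hom_closed[OF that(2)] by (simp add: F.minus_eq A.r_neg)
  note letter = A.free_eval_letter[OF fun_closed] V.R.letter_closed
  consider (add) v w where "v \<in> carrier V" "w \<in> carrier V"
      "p = letter R (v \<oplus>\<^bsub>V\<^esub> w) \<ominus>\<^bsub>F\<^esub> (letter R v \<oplus>\<^bsub>F\<^esub> letter R w)"
    | (smult) r v where "r \<in> carrier R" "v \<in> carrier V"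
      "p = letter R (r \<odot>\<^bsub>V\<^esub> v) \<ominus>\<^bsub>F\<^esub> (r \<odot>\<^bsub>F\<^esub> letter R v)"
    | (comm) v w i j where "v \<in> homog V i" "w \<in> homog V j"
      "p = (letter R v \<otimes>\<^bsub>F\<^esub> letter R w) \<ominus>\<^bsub>F\<^esub> signed F (i * j) (letter R w \<otimes>\<^bsub>F\<^esub> letter R v)"
    using assms unfolding gca_relations_def Let_def by blast
  then show ?thesis
  proof cases
    case add
    show ?thesis unfolding add(3)
      by (rule eq) (use add in \<open>simp_all add: letter graded_linear_on_add[OF linear]\<close>)
  next
    case smult
    show ?thesis unfolding smult(3)
      by (rule eq) (use smult in \<open>simp_all add: letter graded_linear_on_smult[OF linear]
            A.free_eval_smult[OF fun_closed] V.R.free_algebra_smult_closed\<close>)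
  next
    case comm
    note c = V.homog_carrier[OF comm(1)] V.homog_carrier[OF comm(2)]
    have "f v \<otimes>\<^bsub>A\<^esub> f w = signed A (i * j) (f w \<otimes>\<^bsub>A\<^esub> f v)"
      using comm c graded_linear_on_homog[OF linear] by (intro A.graded_commutative) auto
    then show ?thesis unfolding comm(3)
      by (intro eq) (simp_all add: c letter free_eval_signed signed_closed)
  qed
qed

text \<open>The kernel of evaluation is an ideal containing the generators, hence contains the ideal
  they generate.\<close>

lemma free_eval_ideal:
  assumes "p \<in> gca_ideal R V"
  shows "free_eval R A f p = \<zero>\<^bsub>A\<^esub>"
proof -
  have "gca_relations R V \<subseteq> a_kernel F A (free_eval R A f)"
    unfolding a_kernel_def' using gca_relations_closed free_eval_relations by blast
  then have "gca_ideal R V \<subseteq> a_kernel F A (free_eval R A f)"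
    unfolding gca_ideal_def by (rule F.genideal_minimal[OF E.kernel_is_ideal])
  then show ?thesis using assms unfolding a_kernel_def' by blast
qed

lemma gca_lift_class:
  assumes "p \<in> carrier F"
  shows "gca_lift R A f (gca_class R V p) = free_eval R A f p"
proof -
  have "free_eval R A f q = free_eval R A f p" if "q \<in> gca_class R V p" for q
    using that assms I.Icarr free_eval_ideal unfolding gca_class_def a_r_coset_def' by auto
  moreover have "p \<in> gca_class R V p"
    unfolding gca_class_def using assms by (rule I.a_rcos_self)
  ultimately have "free_eval R A f ` gca_class R V p = {free_eval R A f p}" by blast
  then show ?thesis by (simp add: gca_lift_def)
qed

lemma gca_lift_incl: "v \<in> carrier V \<Longrightarrow> gca_lift R A f (gca_incl R V v) = f v"
  by (simp add: gca_incl_def gca_lift_class V.R.letter_closed A.free_eval_letter[OF fun_closed])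

lemma gca_lift_ring_hom: "gca_lift R A f \<in> ring_hom \<Lambda>V A"
  by (rule ring_hom_memI)
     (auto simp: gca_carrier gca_class_mult gca_class_add gca_class_one gca_lift_class)

lemma gca_lift_linear: "linear_map R \<Lambda>V A (gca_lift R A f)"
  unfolding linear_map_def
  by (auto simp: gca_carrier gca_class_add gca_class_smult gca_lift_class
      V.R.free_algebra_smult_closed A.free_eval_smult[OF fun_closed])

lemma gca_lift_homog:
  assumes "x \<in> homog \<Lambda>V n"
  shows "gca_lift R A f x \<in> homog A n"
proof -
  obtain p where p: "p \<in> carrier F" "\<And>w. p w \<noteq> \<zero> \<Longrightarrow> word_of_degree V n w" "x = gca_class R V p"
    using assms by (auto simp: free_gca_def Let_def gca_span_def)
  show ?thesis
    unfolding p(3) gca_lift_class[OF p(1)]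
    by (rule A.free_eval_homog[OF fun_closed _ p(1,2)])
       (use graded_linear_on_homog[OF linear] V.homog_carrier in auto)
qed

text \<open>An element of the image of \<Lambda>W has a representative with letters in W only, and
  evaluation sees nothing else. Thus \<phi>(dw) stays the same when f is changed outside the stage
  that contains the letters of dw.\<close>

lemma gca_lift_cong:
  assumes "W \<subseteq> carrier V" "\<And>v. v \<in> W \<Longrightarrow> f v = g v"
    and "graded_linear_on R V (carrier V) A g" "x \<in> sub_gca R V W"
  shows "gca_lift R A f x = gca_lift R A g x"
proof -
  interpret G: free_gca_lift R V A g by unfold_locales fact
  obtain p where p: "p \<in> carrier (free_algebra R W)" "x = gca_class R V p"
    using assms(4) sub_gca_eq[OF assms(1)] by blast
  have "p \<in> carrier F" using p(1) by (simp add: free_algebra_mono[OF assms(1)])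
  then show ?thesis
    using A.free_eval_cong[OF p(1) fun_closed assms(1,2)] by (simp add: p gca_lift_class G.gca_lift_class)
qed

end

section \<open>Extending graded linear maps along a filtration\<close>

lemma (in graded_module) component_in_graded_submodule:
  assumes W: "submodule W R M" "graded_module R (grade_sub M W)" and "x \<in> W"
  shows "component M i x \<in> W"
proof -
  interpret W: graded_module R "grade_sub M W" by fact
  have sub: "W \<subseteq> carrier M" "\<zero>\<^bsub>M\<^esub> \<in> W"
    using submoduleE(1)[OF W(1)] subgroup.one_closed[OF submodule.axioms(1)[OF W(1)]] by auto
  have "x \<in> carrier (grade_sub M W)" using assms(3) by simp
  then show ?thesis
  proof (induction rule: W.homog_induct)
    case (homog j y)
    then show ?case using component_of_homog[of y j i] sub by simp
  next
    case (add y z)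
    then have "y \<in> carrier M" "z \<in> carrier M" using sub by auto
    then show ?case using add submoduleE(5)[OF W(1)] by (simp add: component_add)
  qed
qed

text \<open>The map sends a + b to f(a) + h(b), which is well defined because the sum is direct.
  Preservation of degrees is the delicate point: the summands of a homogeneous element must
  themselves be shown homogeneous, and this uses that P and Q are graded submodules.\<close>

lemma (in graded_module) graded_linear_glue:
  assumes P: "submodule P R M" "graded_module R (grade_sub M P)"
    and Q: "submodule Q R M" "graded_module R (grade_sub M Q)"
    and sum: "internal_direct_sum M U P Q"
    and A: "graded_module R A"
    and f: "graded_linear_on R M P A f" and h: "graded_linear_on R M Q A h"
  shows "\<exists>g. graded_linear_on R M U A g \<and> (\<forall>x\<in>P. g x = f x) \<and> (\<forall>x\<in>Q. g x = h x)"
proof -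
  interpret A: graded_module R A by fact
  note f_lin = graded_linear_on_closed[OF f] graded_linear_on_add[OF f] graded_linear_on_smult[OF f]
  note h_lin = graded_linear_on_closed[OF h] graded_linear_on_add[OF h] graded_linear_on_smult[OF h]
  note P' = submoduleE(3-5)[OF P(1)] and Q' = submoduleE(3-5)[OF Q(1)]
  have PM: "x \<in> carrier M" if "x \<in> P" for x using submoduleE(1)[OF P(1)] that by blast
  have QM: "x \<in> carrier M" if "x \<in> Q" for x using submoduleE(1)[OF Q(1)] that by blast
  have zero: "\<zero>\<^bsub>M\<^esub> \<in> P" "\<zero>\<^bsub>M\<^esub> \<in> Q"
    using subgroup.one_closed[OF submodule.axioms(1)[OF P(1)]]
      subgroup.one_closed[OF submodule.axioms(1)[OF Q(1)]] by auto
  have U: "x \<in> U \<longleftrightarrow> (\<exists>a\<in>P. \<exists>b\<in>Q. x = a \<oplus>\<^bsub>M\<^esub> b)" for x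
    using sum unfolding internal_direct_sum_def set_add_def' by blast
  have uniq: "a = a' \<and> b = b'"
    if "a \<in> P" "a' \<in> P" "b \<in> Q" "b' \<in> Q" "a \<oplus>\<^bsub>M\<^esub> b = a' \<oplus>\<^bsub>M\<^esub> b'" for a a' b b'
  proof -
    note c = PM[OF that(1)] PM[OF that(2)] QM[OF that(3)] QM[OF that(4)]
    have "\<ominus>\<^bsub>M\<^esub> a' \<oplus>\<^bsub>M\<^esub> a = (\<ominus>\<^bsub>M\<^esub> a' \<oplus>\<^bsub>M\<^esub> (a \<oplus>\<^bsub>M\<^esub> b)) \<oplus>\<^bsub>M\<^esub> \<ominus>\<^bsub>M\<^esub> b"
      using c by (simp add: M.a_assoc M.r_neg)
    also have "\<dots> = b' \<oplus>\<^bsub>M\<^esub> \<ominus>\<^bsub>M\<^esub> b"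
      unfolding that(5) using c by (simp add: M.a_assoc[symmetric] M.l_neg)
    finally have eq: "\<ominus>\<^bsub>M\<^esub> a' \<oplus>\<^bsub>M\<^esub> a = b' \<oplus>\<^bsub>M\<^esub> \<ominus>\<^bsub>M\<^esub> b" .
    have "\<ominus>\<^bsub>M\<^esub> a' \<oplus>\<^bsub>M\<^esub> a \<in> P" "b' \<oplus>\<^bsub>M\<^esub> \<ominus>\<^bsub>M\<^esub> b \<in> Q" using that P' Q' by auto
    then have "\<ominus>\<^bsub>M\<^esub> a' \<oplus>\<^bsub>M\<^esub> a = \<zero>\<^bsub>M\<^esub>" using eq sum unfolding internal_direct_sum_def by auto
    then have "a = a'" using c M.minus_equality[of "\<ominus>\<^bsub>M\<^esub> a'" a] M.minus_minus by (metis M.a_inv_closed)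
    then show ?thesis using that(5) c M.add.l_cancel by metis
  qed
  define g where "g x = (let (a, b) = (SOME (a, b). a \<in> P \<and> b \<in> Q \<and> x = a \<oplus>\<^bsub>M\<^esub> b)
    in f a \<oplus>\<^bsub>A\<^esub> h b)" for x
  have g: "g (a \<oplus>\<^bsub>M\<^esub> b) = f a \<oplus>\<^bsub>A\<^esub> h b" if "a \<in> P" "b \<in> Q" for a b
  proof -
    have "(SOME (a', b'). a' \<in> P \<and> b' \<in> Q \<and> a \<oplus>\<^bsub>M\<^esub> b = a' \<oplus>\<^bsub>M\<^esub> b') = (a, b)"
      by (rule some_equality) (use that uniq in auto)
    then show ?thesis by (simp add: g_def)
  qed
  have "graded_linear_on R M U A g"
  proof (rule graded_linear_onI)
    fix x assume "x \<in> U"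
    then obtain a b where x: "a \<in> P" "b \<in> Q" "x = a \<oplus>\<^bsub>M\<^esub> b" using U by blast
    show "g x \<in> carrier A" unfolding x(3) g[OF x(1,2)] using x f_lin h_lin by simp
    show "g (r \<odot>\<^bsub>M\<^esub> x) = r \<odot>\<^bsub>A\<^esub> g x" if "r \<in> carrier R" for r
    proof -
      have "r \<odot>\<^bsub>M\<^esub> x = r \<odot>\<^bsub>M\<^esub> a \<oplus>\<^bsub>M\<^esub> r \<odot>\<^bsub>M\<^esub> b" using x that PM QM by (simp add: smult_r_distr)
      then show ?thesis
        using x that P' Q' f_lin h_lin by (simp add: g A.smult_r_distr)
    qed
    show "g (x \<oplus>\<^bsub>M\<^esub> y) = g x \<oplus>\<^bsub>A\<^esub> g y" if yU: "y \<in> U" for y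
    proof -
      obtain a' b' where y: "a' \<in> P" "b' \<in> Q" "y = a' \<oplus>\<^bsub>M\<^esub> b'" using yU U by blast
      have "x \<oplus>\<^bsub>M\<^esub> y = (a \<oplus>\<^bsub>M\<^esub> a') \<oplus>\<^bsub>M\<^esub> (b \<oplus>\<^bsub>M\<^esub> b')" using x y PM QM by (simp add: M.a_ac)
      then show ?thesis
        using x y P' Q' f_lin h_lin by (simp add: g A.M.a_ac)
    qed
    show "g x \<in> homog A i" if "x \<in> homog M i" for i
    proof -
      \<comment> \<open>The degree i components of a and b stay in P and Q and have the same sum as
        a and b, so directness forces them to equal a and b.\<close>
      have "component M i a \<oplus>\<^bsub>M\<^esub> component M i b = a \<oplus>\<^bsub>M\<^esub> b"
        using component_of_homog[OF that, of i] x PM QM by (simp add: component_add)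
      then have "component M i a = a \<and> component M i b = b"
        using x component_in_graded_submodule[OF P] component_in_graded_submodule[OF Q]
        by (intro uniq) auto
      then have "a \<in> homog M i" "b \<in> homog M i"
        using component_homog[OF PM[OF x(1)], of i] component_homog[OF QM[OF x(2)], of i] by simp_all
      then show ?thesis
        unfolding x(3) g[OF x(1,2)]
        using x(1,2) graded_linear_on_homog[OF f] graded_linear_on_homog[OF h] by (intro A.homog_add)
    qed
  qed
  moreover have "f \<zero>\<^bsub>M\<^esub> = \<zero>\<^bsub>A\<^esub>" "h \<zero>\<^bsub>M\<^esub> = \<zero>\<^bsub>A\<^esub>"
    using f_lin(3)[OF R.zero_closed zero(1)] h_lin(3)[OF R.zero_closed zero(2)]
      f_lin(1)[OF zero(1)] h_lin(1)[OF zero(2)] by simp_all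
  then have "g x = f x" if "x \<in> P" for x
    using g[OF that zero(2)] f_lin(1)[OF that] PM[OF that] by simp
  moreover have "g x = h x" if "x \<in> Q" for x
    using g[OF zero(1) that] \<open>f \<zero>\<^bsub>M\<^esub> = \<zero>\<^bsub>A\<^esub>\<close> h_lin(1)[OF that] QM[OF that] by simp
  ultimately show ?thesis by blast
qed

text \<open>No condition is put on \<open>U 0\<close>, so every tail of a filtration is again an
  instance; extension from a stage m is treated as a filtration starting there.\<close>

locale graded_filtration = graded_module R M
  for R :: "('r, 'm) ring_scheme" (structure) and M :: "('r, 'a) grmod" (structure) +
  fixes U W :: "nat \<Rightarrow> 'a set"
  assumes U_submodule: "submodule (U k) R M"
    and U_graded: "graded_module R (grade_sub M (U k))"
    and W_submodule: "submodule (W k) R M"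
    and W_graded: "graded_module R (grade_sub M (W k))"
    and U_Suc: "U k \<subseteq> U (Suc k)"
    and U_exhausts: "carrier M = (\<Union>k. U k)"
    and U_complement: "internal_direct_sum M (U (Suc k)) (U k) (W k)"
begin

lemma U_mono: "k \<le> l \<Longrightarrow> U k \<subseteq> U l"
  using U_Suc by (rule lift_Suc_mono_le)

lemma graded_linear_union:
  assumes f: "\<And>n. graded_linear_on R M (U n) A (f n)"
    and f_Suc: "\<And>n x. x \<in> U n \<Longrightarrow> f (Suc n) x = f n x"
  shows "\<exists>g. graded_linear_on R M (carrier M) A g \<and> (\<forall>n. \<forall>x\<in>U n. g x = f n x)"
proof -
  have f_mono: "f (n + m) x = f n x" if "x \<in> U n" for x n m
  proof (induction m)
    case (Suc m)
    have "x \<in> U (n + m)" using U_mono[of n "n + m"] that by auto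
    then show ?case using f_Suc[of x "n + m"] Suc by simp
  qed simp
  \<comment> \<open>The least stage is merely a canonical choice; by compatibility any stage
    containing x gives the same value.\<close>
  define g where "g x = f (LEAST n. x \<in> U n) x" for x
  have g: "g x = f n x" if "x \<in> U n" for n x
    using f_mono[OF LeastI[of "\<lambda>n. x \<in> U n", OF that], of "n - (LEAST n. x \<in> U n)"]
      Least_le[of "\<lambda>n. x \<in> U n", OF that] by (simp add: g_def)
  have "graded_linear_on R M (carrier M) A g"
  proof (rule graded_linear_onI)
    fix x assume "x \<in> carrier M"
    then obtain n where x: "x \<in> U n" using U_exhausts by blast
    show "g x \<in> carrier A" using g[OF x] graded_linear_on_closed[OF f x] by simp
    show "g (r \<odot>\<^bsub>M\<^esub> x) = r \<odot>\<^bsub>A\<^esub> g x" if "r \<in> carrier R" for r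
      using g[OF x] g[OF submoduleE(4)[OF U_submodule that x]] graded_linear_on_smult[OF f that x]
      by simp
    show "g x \<in> homog A i" if "x \<in> homog M i" for i
      using g[OF x] graded_linear_on_homog[OF f that x] by simp
    show "g (x \<oplus>\<^bsub>M\<^esub> y) = g x \<oplus>\<^bsub>A\<^esub> g y" if yM: "y \<in> carrier M" for y
    proof -
      obtain m where "y \<in> U m" using yM U_exhausts by blast
      then have y: "y \<in> U (n + m)" and x': "x \<in> U (n + m)"
        using x U_mono[of n "n + m"] U_mono[of m "n + m"] by auto
      show ?thesis
        using g[OF x'] g[OF y] g[OF submoduleE(5)[OF U_submodule x' y]]
          graded_linear_on_add[OF f x' y] by simp
    qed
  qed
  then show ?thesis using g by blast
qed

end

lemma graded_linear_on_zero:
  assumes "graded_module R A"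
  shows "graded_linear_on R V W A (\<lambda>x. \<zero>\<^bsub>A\<^esub>)"
proof -
  interpret A: graded_module R A by fact
  show ?thesis by (rule graded_linear_onI) simp_all
qed

lemma (in graded_filtration) shift: "graded_filtration R M (\<lambda>n. U (m + n)) (\<lambda>n. W (m + n))"
proof (intro graded_filtration.intro graded_filtration_axioms.intro graded_module_axioms)
  show "carrier M = (\<Union>k. U (m + k))"
    using U_exhausts U_mono[OF le_add2] by (fastforce simp: set_eq_iff)
  show "internal_direct_sum M (U (m + Suc k)) (U (m + k)) (W (m + k))" for k
    using U_complement by simp
  show "U (m + k) \<subseteq> U (m + Suc k)" for k
    using U_Suc by simp
qed (rule U_submodule U_graded W_submodule W_graded)+

text \<open>The map is extended by zero on each complement \<open>W m\<close>,
  \<open>W (m + 1)\<close>, and so on, and the union of these extensions is taken.\<close>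

lemma (in graded_filtration) graded_linear_extend:
  assumes A: "graded_module R A" and f: "graded_linear_on R M (U m) A f"
  shows "\<exists>g. graded_linear_on R M (carrier M) A g \<and> (\<forall>x\<in>U m. g x = f x)"
proof -
  interpret S: graded_filtration R M "\<lambda>n. U (m + n)" "\<lambda>n. W (m + n)" by (rule shift)
  \<comment> \<open>Dependent choice only promises some initial value; the clause for n = 0 forces
    the sequence to start at f.\<close>
  have "\<exists>F. \<forall>n. (graded_linear_on R M (U (m + n)) A (F n) \<and> (n = 0 \<longrightarrow> F n = f)) \<and>
      (\<forall>x\<in>U (m + n). F (Suc n) x = F n x)"
  proof (rule dependent_nat_choice)
    fix g n assume "graded_linear_on R M (U (m + n)) A g \<and> (n = 0 \<longrightarrow> g = f)"
    then show "\<exists>g'. (graded_linear_on R M (U (m + Suc n)) A g' \<and> (Suc n = 0 \<longrightarrow> g' = f)) \<and>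
        (\<forall>x\<in>U (m + n). g' x = g x)"
      using graded_linear_glue[OF U_submodule U_graded W_submodule W_graded U_complement A _
          graded_linear_on_zero[OF A], of "m + n" g] by auto
  qed (use f in auto)
  then obtain F where F: "\<And>n. graded_linear_on R M (U (m + n)) A (F n)" "F 0 = f"
    "\<And>n x. x \<in> U (m + n) \<Longrightarrow> F (Suc n) x = F n x" by blast
  obtain g where "graded_linear_on R M (carrier M) A g" "\<And>n x. x \<in> U (m + n) \<Longrightarrow> g x = F n x"
    using S.graded_linear_union[OF F(1,3)] by blast
  moreover from this(2)[of _ 0] have "g x = f x" if "x \<in> U m" for x
    using that F(2) by simp
  ultimately show ?thesis by blast
qed

section \<open>Projectivity of graded free modules\<close>

definition coefficient ::
  "('r, 'm) ring_scheme \<Rightarrow> ('r, 'v) grmod \<Rightarrow> 'v set \<Rightarrow> 'v \<Rightarrow> 'v \<Rightarrow> 'r" where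
  "coefficient R M S x = (THE c. (\<forall>b. c b \<in> carrier R) \<and>
     finite {b. c b \<noteq> \<zero>\<^bsub>R\<^esub>} \<and> {b. c b \<noteq> \<zero>\<^bsub>R\<^esub>} \<subseteq> S \<and>
     x = finsum M (\<lambda>b. c b \<odot>\<^bsub>M\<^esub> b) {b. c b \<noteq> \<zero>\<^bsub>R\<^esub>})"

context module
begin

lemma
  assumes "is_basis R N S" "x \<in> carrier N"
  shows coefficient_closed: "coefficient R N S x b \<in> carrier R"
    and finite_coefficients: "finite {b. coefficient R N S x b \<noteq> \<zero>}"
    and coefficient_support: "{b. coefficient R N S x b \<noteq> \<zero>} \<subseteq> S"
    and finsum_coefficients: "x = finsum N (\<lambda>b. coefficient R N S x b \<odot>\<^bsub>N\<^esub> b)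
      {b. coefficient R N S x b \<noteq> \<zero>}"
proof -
  have "\<exists>!c. (\<forall>b. c b \<in> carrier R) \<and> finite {b. c b \<noteq> \<zero>} \<and> {b. c b \<noteq> \<zero>} \<subseteq> S \<and>
      x = finsum N (\<lambda>b. c b \<odot>\<^bsub>N\<^esub> b) {b. c b \<noteq> \<zero>}"
    using assms unfolding is_basis_def by blast
  from theI'[OF this] show "coefficient R N S x b \<in> carrier R"
    "finite {b. coefficient R N S x b \<noteq> \<zero>}" "{b. coefficient R N S x b \<noteq> \<zero>} \<subseteq> S"
    "x = finsum N (\<lambda>b. coefficient R N S x b \<odot>\<^bsub>N\<^esub> b) {b. coefficient R N S x b \<noteq> \<zero>}"
    unfolding coefficient_def by blast+
qed

end

text \<open>The relation \<open>P\<close> stands for a submodule of \<open>N \<oplus> A\<close> projecting onto \<open>N\<close>, of which \<open>h\<close> is a section.\<close>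

lemma free_module_lift:
  assumes N: "free_module R N" and A: "module R A" and K: "submodule K R A"
    and P_zero: "P \<zero>\<^bsub>N\<^esub> \<zero>\<^bsub>A\<^esub>"
    and P_add: "\<And>x y a b. x \<in> carrier N \<Longrightarrow> y \<in> carrier N \<Longrightarrow> a \<in> carrier A \<Longrightarrow> b \<in> carrier A \<Longrightarrow>
      P x a \<Longrightarrow> P y b \<Longrightarrow> P (x \<oplus>\<^bsub>N\<^esub> y) (a \<oplus>\<^bsub>A\<^esub> b)"
    and P_smult: "\<And>r x a. r \<in> carrier R \<Longrightarrow> x \<in> carrier N \<Longrightarrow> a \<in> carrier A \<Longrightarrow> P x a \<Longrightarrow>
      P (r \<odot>\<^bsub>N\<^esub> x) (r \<odot>\<^bsub>A\<^esub> a)"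
    and lift: "\<And>x. x \<in> carrier N \<Longrightarrow> \<exists>a\<in>K. P x a"
  shows "\<exists>h. linear_map R N A h \<and> (\<forall>x\<in>carrier N. h x \<in> K \<and> P x (h x))"
proof -
  interpret N: module R N using N unfolding free_module_def by blast
  interpret A: module R A by fact
  obtain S where S: "is_basis R N S" using N unfolding free_module_def by blast
  have SN: "S \<subseteq> carrier N" using S unfolding is_basis_def by blast
  have KA: "a \<in> carrier A" if "a \<in> K" for a using A.submoduleE(1)[OF K] that by blast
  obtain g where g: "\<And>b. b \<in> S \<Longrightarrow> g b \<in> K \<and> P b (g b)"
    using lift SN by (metis subset_iff)
  let ?c = "coefficient R N S"
  note c = N.coefficient_closed[OF S] N.finite_coefficients[OF S] N.coefficient_support[OF S]
  define h where "h x = finsum A (\<lambda>b. ?c x b \<odot>\<^bsub>A\<^esub> g b) {b. ?c x b \<noteq> \<zero>\<^bsub>R\<^esub>}" for x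
  \<comment> \<open>Coordinates can be read off from any expansion over a finite part J of the
    basis, so those of a sum or a multiple are found even if cancellation shrinks the
    support.\<close>
  have unique: "?c x = e"
    if "\<And>b. e b \<in> carrier R" "finite J" "{b. e b \<noteq> \<zero>\<^bsub>R\<^esub>} \<subseteq> J" "J \<subseteq> S"
      "x = finsum N (\<lambda>b. e b \<odot>\<^bsub>N\<^esub> b) J" for x e J
  proof -
    have t: "e b \<odot>\<^bsub>N\<^esub> b \<in> carrier N" if "b \<in> J" for b
      using \<open>\<And>b. e b \<in> carrier R\<close> \<open>J \<subseteq> S\<close> SN that by auto
    have "x = finsum N (\<lambda>b. e b \<odot>\<^bsub>N\<^esub> b) {b. e b \<noteq> \<zero>\<^bsub>R\<^esub>}"
      unfolding that(5) by (rule N.M.finsum_superset) (use that t SN in auto)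
    moreover have "x \<in> carrier N" unfolding that(5) using t by (intro N.M.finsum_closed) auto
    then have "\<exists>!c. (\<forall>b. c b \<in> carrier R) \<and> finite {b. c b \<noteq> \<zero>\<^bsub>R\<^esub>} \<and> {b. c b \<noteq> \<zero>\<^bsub>R\<^esub>} \<subseteq> S \<and>
      x = finsum N (\<lambda>b. c b \<odot>\<^bsub>N\<^esub> b) {b. c b \<noteq> \<zero>\<^bsub>R\<^esub>}"
      using S unfolding is_basis_def by blast
    ultimately show ?thesis
      unfolding coefficient_def using that(1-4) finite_subset[OF that(3,2)]
      by (intro the1_equality) auto
  qed
  have superset: "finsum N (\<lambda>b. ?c x b \<odot>\<^bsub>N\<^esub> b) J = x"
    "h x = finsum A (\<lambda>b. ?c x b \<odot>\<^bsub>A\<^esub> g b) J"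
    if "x \<in> carrier N" "finite J" "{b. ?c x b \<noteq> \<zero>\<^bsub>R\<^esub>} \<subseteq> J" "J \<subseteq> S" for x J
  proof -
    have J: "b \<in> carrier N" "g b \<in> carrier A" if "b \<in> J" for b
      using \<open>J \<subseteq> S\<close> SN g KA that by auto
    have "finsum N (\<lambda>b. ?c x b \<odot>\<^bsub>N\<^esub> b) J = finsum N (\<lambda>b. ?c x b \<odot>\<^bsub>N\<^esub> b) {b. ?c x b \<noteq> \<zero>\<^bsub>R\<^esub>}"
      by (rule N.M.finsum_superset) (use that J c(1) in auto)
    then show "finsum N (\<lambda>b. ?c x b \<odot>\<^bsub>N\<^esub> b) J = x"
      using N.finsum_coefficients[OF S that(1)] by simp
    show "h x = finsum A (\<lambda>b. ?c x b \<odot>\<^bsub>A\<^esub> g b) J"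
      unfolding h_def by (rule A.M.finsum_superset[symmetric]) (use that J c(1) in auto)
  qed
  \<comment> \<open>Closure of \<open>P\<close> and K under sums and multiples carries the relation
    from the basis vectors to all their finite combinations.\<close>
  have sum: "finsum A (\<lambda>b. e b \<odot>\<^bsub>A\<^esub> g b) J \<in> K \<and>
      P (finsum N (\<lambda>b. e b \<odot>\<^bsub>N\<^esub> b) J) (finsum A (\<lambda>b. e b \<odot>\<^bsub>A\<^esub> g b) J)"
    if "finite J" "J \<subseteq> S" "\<And>b. e b \<in> carrier R" for J e
    using that(1,2)
  proof (induction J)
    case empty
    then show ?case
      using P_zero subgroup.one_closed[OF submodule.axioms(1)[OF K]] by simp
  next
    case (insert b J)
    have b: "b \<in> carrier N" "g b \<in> K" "g b \<in> carrier A" "P b (g b)"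
      using insert.prems SN g KA by auto
    have J: "b' \<in> carrier N" "g b' \<in> carrier A" if "b' \<in> J" for b'
      using insert.prems SN g KA that by auto
    have "finsum N (\<lambda>b. e b \<odot>\<^bsub>N\<^esub> b) (insert b J) = e b \<odot>\<^bsub>N\<^esub> b \<oplus>\<^bsub>N\<^esub> finsum N (\<lambda>b. e b \<odot>\<^bsub>N\<^esub> b) J"
      using insert.hyps b J that(3) by (intro N.M.finsum_insert) auto
    moreover have "finsum A (\<lambda>b. e b \<odot>\<^bsub>A\<^esub> g b) (insert b J) =
        e b \<odot>\<^bsub>A\<^esub> g b \<oplus>\<^bsub>A\<^esub> finsum A (\<lambda>b. e b \<odot>\<^bsub>A\<^esub> g b) J"
      using insert.hyps b J that(3) by (intro A.M.finsum_insert) auto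
    moreover have "finsum N (\<lambda>b. e b \<odot>\<^bsub>N\<^esub> b) J \<in> carrier N"
      using J that(3) by (intro N.M.finsum_closed) auto
    moreover have "finsum A (\<lambda>b. e b \<odot>\<^bsub>A\<^esub> g b) J \<in> K"
      "P (finsum N (\<lambda>b. e b \<odot>\<^bsub>N\<^esub> b) J) (finsum A (\<lambda>b. e b \<odot>\<^bsub>A\<^esub> g b) J)"
      using insert by auto
    ultimately show ?case
      using b that(3) KA A.submoduleE(4,5)[OF K] by (auto intro!: P_add P_smult)
  qed
  have h: "h x \<in> K \<and> P x (h x)" if "x \<in> carrier N" for x
    using sum[OF c(2,3)[OF that], of "?c x"] c(1)[OF that] superset[OF that c(2)[OF that] _ c(3)[OF that]]
    by simp
  have "linear_map R N A h"
    unfolding linear_map_def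
  proof (intro conjI ballI)
    show "h \<in> carrier N \<rightarrow> carrier A" using h KA by blast
  next
    fix x y assume x: "x \<in> carrier N" and y: "y \<in> carrier N"
    let ?J = "{b. ?c x b \<noteq> \<zero>\<^bsub>R\<^esub>} \<union> {b. ?c y b \<noteq> \<zero>\<^bsub>R\<^esub>}"
    have J: "finite ?J" "?J \<subseteq> S" using c(2,3)[OF x] c(2,3)[OF y] by auto
    have JN: "b \<in> carrier N" "g b \<in> carrier A" if "b \<in> ?J" for b
      using J(2) SN g KA that by blast+
    note cc = c(1)[OF x] c(1)[OF y]
    have cxy: "?c (x \<oplus>\<^bsub>N\<^esub> y) = (\<lambda>b. ?c x b \<oplus>\<^bsub>R\<^esub> ?c y b)"
    proof (rule unique[OF _ J(1) _ J(2)])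
      have "(\<Oplus>\<^bsub>N\<^esub>b\<in>?J. (?c x b \<oplus>\<^bsub>R\<^esub> ?c y b) \<odot>\<^bsub>N\<^esub> b) =
          (\<Oplus>\<^bsub>N\<^esub>b\<in>?J. ?c x b \<odot>\<^bsub>N\<^esub> b \<oplus>\<^bsub>N\<^esub> ?c y b \<odot>\<^bsub>N\<^esub> b)"
        using JN cc by (intro N.M.finsum_cong') (auto simp: N.smult_l_distr)
      also have "\<dots> = x \<oplus>\<^bsub>N\<^esub> y"
        using JN cc superset(1)[OF x J(1) _ J(2)] superset(1)[OF y J(1) _ J(2)]
        by (subst N.M.finsum_addf) auto
      finally show "x \<oplus>\<^bsub>N\<^esub> y = (\<Oplus>\<^bsub>N\<^esub>b\<in>?J. (?c x b \<oplus>\<^bsub>R\<^esub> ?c y b) \<odot>\<^bsub>N\<^esub> b)" by simp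
    qed (use cc in auto)
    have "{b. ?c x b \<oplus>\<^bsub>R\<^esub> ?c y b \<noteq> \<zero>\<^bsub>R\<^esub>} \<subseteq> ?J" by auto
    then have "h (x \<oplus>\<^bsub>N\<^esub> y) = (\<Oplus>\<^bsub>A\<^esub>b\<in>?J. (?c x b \<oplus>\<^bsub>R\<^esub> ?c y b) \<odot>\<^bsub>A\<^esub> g b)"
      using superset(2)[of "x \<oplus>\<^bsub>N\<^esub> y", OF _ J(1) _ J(2)] x y unfolding cxy by simp
    also have "\<dots> = (\<Oplus>\<^bsub>A\<^esub>b\<in>?J. ?c x b \<odot>\<^bsub>A\<^esub> g b \<oplus>\<^bsub>A\<^esub> ?c y b \<odot>\<^bsub>A\<^esub> g b)"
      using JN cc by (intro A.M.finsum_cong') (auto simp: A.smult_l_distr)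
    also have "\<dots> = h x \<oplus>\<^bsub>A\<^esub> h y"
      using JN cc superset(2)[OF x J(1) _ J(2)] superset(2)[OF y J(1) _ J(2)]
      by (subst A.M.finsum_addf) auto
    finally show "h (x \<oplus>\<^bsub>N\<^esub> y) = h x \<oplus>\<^bsub>A\<^esub> h y" .
  next
    fix r x assume r: "r \<in> carrier R" and x: "x \<in> carrier N"
    let ?J = "{b. ?c x b \<noteq> \<zero>\<^bsub>R\<^esub>}"
    note J = c(2,3)[OF x] and cc = c(1)[OF x]
    have JN: "b \<in> carrier N" "g b \<in> carrier A" if "b \<in> ?J" for b
      using J(2) SN g KA that by blast+
    have crx: "?c (r \<odot>\<^bsub>N\<^esub> x) = (\<lambda>b. r \<otimes>\<^bsub>R\<^esub> ?c x b)"
    proof (rule unique[OF _ J(1) _ J(2)])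
      have "(\<Oplus>\<^bsub>N\<^esub>b\<in>?J. (r \<otimes>\<^bsub>R\<^esub> ?c x b) \<odot>\<^bsub>N\<^esub> b) = (\<Oplus>\<^bsub>N\<^esub>b\<in>?J. r \<odot>\<^bsub>N\<^esub> (?c x b \<odot>\<^bsub>N\<^esub> b))"
        using JN cc r by (intro N.M.finsum_cong') (auto simp: N.smult_assoc1)
      also have "\<dots> = r \<odot>\<^bsub>N\<^esub> x"
        using JN cc r superset(1)[OF x J(1) _ J(2)] J
        by (subst N.finsum_smult_ldistr[symmetric]) auto
      finally show "r \<odot>\<^bsub>N\<^esub> x = (\<Oplus>\<^bsub>N\<^esub>b\<in>?J. (r \<otimes>\<^bsub>R\<^esub> ?c x b) \<odot>\<^bsub>N\<^esub> b)" by simp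
    qed (use cc r in auto)
    have "{b. r \<otimes>\<^bsub>R\<^esub> ?c x b \<noteq> \<zero>\<^bsub>R\<^esub>} \<subseteq> ?J" using r by auto
    then have "h (r \<odot>\<^bsub>N\<^esub> x) = (\<Oplus>\<^bsub>A\<^esub>b\<in>?J. (r \<otimes>\<^bsub>R\<^esub> ?c x b) \<odot>\<^bsub>A\<^esub> g b)"
      using superset(2)[of "r \<odot>\<^bsub>N\<^esub> x", OF _ J(1) _ J(2)] x r unfolding crx by simp
    also have "\<dots> = (\<Oplus>\<^bsub>A\<^esub>b\<in>?J. r \<odot>\<^bsub>A\<^esub> (?c x b \<odot>\<^bsub>A\<^esub> g b))"
      using JN cc r by (intro A.M.finsum_cong') (auto simp: A.smult_assoc1)
    also have "\<dots> = r \<odot>\<^bsub>A\<^esub> h x"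
      unfolding h_def using JN cc r J by (subst A.finsum_smult_ldistr[symmetric]) auto
    finally show "h (r \<odot>\<^bsub>N\<^esub> x) = r \<odot>\<^bsub>A\<^esub> h x" .
  qed
  then show ?thesis using h by blast
qed

text \<open>Freeness is given for each homogeneous part separately, so linear sections are chosen
  degree by degree, with \<open>homog A i\<close> in the role of K, and then summed over the
  components of x. The relation \<open>P\<close> itself need not refer to degrees.\<close>

lemma graded_free_module_lift:
  assumes N: "graded_free_module R N" and A: "graded_module R A"
    and P_zero: "P \<zero>\<^bsub>N\<^esub> \<zero>\<^bsub>A\<^esub>"
    and P_add: "\<And>x y a b. x \<in> carrier N \<Longrightarrow> y \<in> carrier N \<Longrightarrow> a \<in> carrier A \<Longrightarrow> b \<in> carrier A \<Longrightarrow>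
      P x a \<Longrightarrow> P y b \<Longrightarrow> P (x \<oplus>\<^bsub>N\<^esub> y) (a \<oplus>\<^bsub>A\<^esub> b)"
    and P_smult: "\<And>r x a. r \<in> carrier R \<Longrightarrow> x \<in> carrier N \<Longrightarrow> a \<in> carrier A \<Longrightarrow> P x a \<Longrightarrow>
      P (r \<odot>\<^bsub>N\<^esub> x) (r \<odot>\<^bsub>A\<^esub> a)"
    and lift: "\<And>i x. x \<in> homog N i \<Longrightarrow> \<exists>a\<in>homog A i. P x a"
  shows "\<exists>h. graded_linear_on R N (carrier N) A h \<and> (\<forall>x\<in>carrier N. P x (h x))"
proof -
  interpret N: graded_module R N using N unfolding graded_free_module_def by blast
  interpret A: graded_module R A by fact
  have "\<exists>h. linear_map R (N\<lparr>carrier := homog N i\<rparr>) A h \<and>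
      (\<forall>x\<in>carrier (N\<lparr>carrier := homog N i\<rparr>). h x \<in> homog A i \<and> P x (h x))" for i
  proof (rule free_module_lift)
    show "free_module R (N\<lparr>carrier := homog N i\<rparr>)" using N unfolding graded_free_module_def by blast
  qed (use A.module_axioms A.homog_submodule lift N.homog_carrier P_zero P_add P_smult in auto)
  then obtain hh where hh: "\<And>i. linear_map R (N\<lparr>carrier := homog N i\<rparr>) A (hh i)"
    and hh': "\<And>i x. x \<in> homog N i \<Longrightarrow> hh i x \<in> homog A i \<and> P x (hh i x)"
    by (metis partial_object.select_convs(1) partial_object.surjective partial_object.update_convs(1))
  then have hh_add: "hh i (x \<oplus>\<^bsub>N\<^esub> y) = hh i x \<oplus>\<^bsub>A\<^esub> hh i y"
    if "x \<in> homog N i" "y \<in> homog N i" for i x y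
    using that unfolding linear_map_def by auto
  have hh_smult: "hh i (r \<odot>\<^bsub>N\<^esub> x) = r \<odot>\<^bsub>A\<^esub> hh i x" if "x \<in> homog N i" "r \<in> carrier R" for i x r
    using that hh unfolding linear_map_def by auto
  have hhA: "hh i x \<in> carrier A" if "x \<in> homog N i" for i x
    using hh'[OF that] A.homog_carrier by blast
  have hh0: "hh i \<zero>\<^bsub>N\<^esub> = \<zero>\<^bsub>A\<^esub>" for i
    using hh_smult[OF N.homog_zero N.R.zero_closed, of i]
      A.smult_l_null[OF hhA[OF N.homog_zero, of i]] by simp
  define h where "h x = finsum A (\<lambda>i. hh i (component N i x)) {i. component N i x \<noteq> \<zero>\<^bsub>N\<^esub>}" for x
  have superset: "h x = finsum A (\<lambda>i. hh i (component N i x)) J"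
    if "x \<in> carrier N" "finite J" "{i. component N i x \<noteq> \<zero>\<^bsub>N\<^esub>} \<subseteq> J" for x J
    unfolding h_def by (rule A.M.finsum_superset[symmetric])
      (use that hhA hh0 N.component_homog in auto)
  have sum: "P (finsum N (\<lambda>i. component N i x) J) (finsum A (\<lambda>i. hh i (component N i x)) J)"
    if "finite J" "x \<in> carrier N" for J x
    using that(1)
  proof (induction J)
    case empty
    then show ?case using P_zero by simp
  next
    case (insert i J)
    note c = N.component_carrier[OF that(2)] hhA[OF N.component_homog[OF that(2)]]
    have "finsum N (\<lambda>i. component N i x) (insert i J) =
        component N i x \<oplus>\<^bsub>N\<^esub> finsum N (\<lambda>i. component N i x) J"
      using insert.hyps c by (intro N.M.finsum_insert) auto
    moreover have "finsum A (\<lambda>i. hh i (component N i x)) (insert i J) =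
        hh i (component N i x) \<oplus>\<^bsub>A\<^esub> finsum A (\<lambda>i. hh i (component N i x)) J"
      using insert.hyps c by (intro A.M.finsum_insert) auto
    ultimately show ?case
      using insert.IH c hh'[OF N.component_homog[OF that(2)], of i]
      by (simp add: P_add Pi_def)
  qed
  have "P x (h x)" if "x \<in> carrier N" for x
    using sum[OF N.finite_components[OF that] that] N.finsum_components[OF that] unfolding h_def by simp
  moreover have "graded_linear_on R N (carrier N) A h"
  proof (rule graded_linear_onI)
    fix x assume x: "x \<in> carrier N"
    let ?J = "{i. component N i x \<noteq> \<zero>\<^bsub>N\<^esub>}"
    note J = N.finite_components[OF x]
    note c = hhA[OF N.component_homog[OF x]]
    show "h x \<in> carrier A" unfolding h_def using c by (intro A.M.finsum_closed) auto
    show "h x \<in> homog A i" if "x \<in> homog N i" for i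
    proof -
      have "h x = finsum A (\<lambda>i. hh i (component N i x)) {i}"
        by (rule superset) (use x N.component_of_homog[OF that] in auto)
      then show ?thesis using N.component_of_homog[OF that] hh'[OF that] hhA[OF that] by simp
    qed
    show "h (r \<odot>\<^bsub>N\<^esub> x) = r \<odot>\<^bsub>A\<^esub> h x" if r: "r \<in> carrier R" for r
    proof -
      have "h (r \<odot>\<^bsub>N\<^esub> x) = finsum A (\<lambda>i. hh i (component N i (r \<odot>\<^bsub>N\<^esub> x))) ?J"
        by (rule superset) (use x r J in \<open>auto simp: N.component_smult\<close>)
      also have "\<dots> = finsum A (\<lambda>i. r \<odot>\<^bsub>A\<^esub> hh i (component N i x)) ?J"
        using x r c N.component_homog[OF x]
        by (intro A.M.finsum_cong') (auto simp: N.component_smult hh_smult)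
      also have "\<dots> = r \<odot>\<^bsub>A\<^esub> h x"
        unfolding h_def using r c J by (subst A.finsum_smult_ldistr[symmetric]) auto
      finally show ?thesis .
    qed
    show "h (x \<oplus>\<^bsub>N\<^esub> y) = h x \<oplus>\<^bsub>A\<^esub> h y" if y: "y \<in> carrier N" for y
    proof -
      let ?K = "?J \<union> {i. component N i y \<noteq> \<zero>\<^bsub>N\<^esub>}"
      have K: "finite ?K" using J N.finite_components[OF y] by simp
      note c' = hhA[OF N.component_homog[OF y]]
      have "h (x \<oplus>\<^bsub>N\<^esub> y) = finsum A (\<lambda>i. hh i (component N i (x \<oplus>\<^bsub>N\<^esub> y))) ?K"
        by (rule superset) (use x y K in \<open>auto simp: N.component_add\<close>)
      also have "\<dots> = finsum A (\<lambda>i. hh i (component N i x) \<oplus>\<^bsub>A\<^esub> hh i (component N i y)) ?K"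
        using x y c c' N.component_homog
        by (intro A.M.finsum_cong') (auto simp: N.component_add hh_add)
      also have "\<dots> = h x \<oplus>\<^bsub>A\<^esub> h y"
        using c c' superset[OF x K] superset[OF y K] by (subst A.M.finsum_addf) auto
      finally show ?thesis .
    qed
  qed
  ultimately show ?thesis by blast
qed

section \<open>Lifting through surjective quasi-isomorphisms\<close>

lemma coboundaries_subgroup:
  assumes "cdga R A d"
  shows "abelian_subgroup (coboundaries A d) A"
proof -
  interpret A: cdga R A d by fact
  note d = linear_map_closed[OF A.diff_linear] linear_map_add[OF A.diff_linear]
    linear_map_smult[OF A.diff_linear]
  have d0: "d \<zero>\<^bsub>A\<^esub> = \<zero>\<^bsub>A\<^esub>"
    by (rule linear_map_zero[OF A.module_axioms A.module_axioms A.diff_linear])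
  have "submodule (coboundaries A d) R A"
  proof (rule A.submoduleI)
    show "coboundaries A d \<subseteq> carrier A" using d by (auto simp: coboundaries_def)
    show "\<zero>\<^bsub>A\<^esub> \<in> coboundaries A d"
      unfolding coboundaries_def using imageI[OF A.M.zero_closed, of d] d0 by simp
    show sm: "r \<odot>\<^bsub>A\<^esub> x \<in> coboundaries A d"
      if "r \<in> carrier R" "x \<in> coboundaries A d" for r x
      using that d(3) unfolding coboundaries_def by (metis (no_types) A.smult_closed imageE imageI)
    \<comment> \<open>Negation is multiplication by the scalar -1, so closure under scalars
      applies.\<close>
    show "\<ominus>\<^bsub>A\<^esub> x \<in> coboundaries A d" if x: "x \<in> coboundaries A d" for x
    proof -
      have "x \<in> carrier A" using x d(1) by (auto simp: coboundaries_def)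
      then have "\<ominus>\<^bsub>A\<^esub> x = (\<ominus>\<^bsub>R\<^esub> \<one>\<^bsub>R\<^esub>) \<odot>\<^bsub>A\<^esub> x" by (simp add: A.smult_l_minus)
      then show ?thesis using sm[OF _ x] by simp
    qed
    show "x \<oplus>\<^bsub>A\<^esub> y \<in> coboundaries A d"
      if "x \<in> coboundaries A d" "y \<in> coboundaries A d" for x y
      using that d(2) unfolding coboundaries_def by (metis (no_types) A.M.a_closed imageE imageI)
  qed
  then show ?thesis
    using A.M.abelian_group_axioms by (intro abelian_subgroupI3 additive_subgroupI submodule.axioms(1))
qed

text \<open>Cosets depend only on addition, which restricting the carrier to the cocycles leaves
  unchanged; the classes are therefore cosets formed in A itself.\<close>

lemma cohomology_carrier:
  "carrier (cohomology A d) =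
    (\<lambda>z. coboundaries A d +>\<^bsub>A\<^esub> z) ` {z \<in> carrier A. d z = \<zero>\<^bsub>A\<^esub>}"
  by (auto simp: cohomology_def FactRing_def A_RCOSETS_def' a_r_coset_def')

locale cdga_hom = A: cdga R A dA + B: cdga R B dB
  for R :: "('r, 'm) ring_scheme" (structure) and A :: "('r, 'a) grmod" and dA
    and B :: "('r, 'b) grmod" and dB and \<eta> +
  assumes morphism: "cdga_morphism R A dA B dB \<eta>"
begin

lemma hom_linear: "linear_map R A B \<eta>"
  and hom_diff: "x \<in> carrier A \<Longrightarrow> \<eta> (dA x) = dB (\<eta> x)"
  and hom_ring: "\<eta> \<in> ring_hom A B"
  and hom_homog: "x \<in> homog A i \<Longrightarrow> \<eta> x \<in> homog B i"
  using morphism unfolding cdga_morphism_def by auto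

lemma
  shows hom_closed: "x \<in> carrier A \<Longrightarrow> \<eta> x \<in> carrier B"
    and hom_add: "x \<in> carrier A \<Longrightarrow> y \<in> carrier A \<Longrightarrow> \<eta> (x \<oplus>\<^bsub>A\<^esub> y) = \<eta> x \<oplus>\<^bsub>B\<^esub> \<eta> y"
    and hom_smult: "r \<in> carrier R \<Longrightarrow> x \<in> carrier A \<Longrightarrow> \<eta> (r \<odot>\<^bsub>A\<^esub> x) = r \<odot>\<^bsub>B\<^esub> \<eta> x"
    and hom_zero: "\<eta> \<zero>\<^bsub>A\<^esub> = \<zero>\<^bsub>B\<^esub>"
  using linear_map_closed[OF hom_linear] linear_map_add[OF hom_linear]
    linear_map_smult[OF hom_linear]
    linear_map_zero[OF A.module_axioms B.module_axioms hom_linear] by blast+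

text \<open>\<eta> carries coboundaries to coboundaries, so all representatives contribute the same
  coset and the union in \<open>cohomology_map\<close> collapses.\<close>

lemma cohomology_map_class:
  assumes z: "z \<in> carrier A"
  shows "cohomology_map B dB \<eta> (coboundaries A dA +>\<^bsub>A\<^esub> z) = coboundaries B dB +>\<^bsub>B\<^esub> \<eta> z"
proof -
  interpret IA: abelian_subgroup "coboundaries A dA" A
    by (rule coboundaries_subgroup) (rule A.cdga_axioms)
  interpret IB: abelian_subgroup "coboundaries B dB" B
    by (rule coboundaries_subgroup) (rule B.cdga_axioms)
  have "coboundaries B dB +>\<^bsub>B\<^esub> \<eta> x = coboundaries B dB +>\<^bsub>B\<^esub> \<eta> z"
    if x: "x \<in> coboundaries A dA +>\<^bsub>A\<^esub> z" for x
  proof -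
    obtain y where y: "y \<in> carrier A" "x = dA y \<oplus>\<^bsub>A\<^esub> z"
      using x unfolding a_r_coset_def' coboundaries_def by blast
    have "\<eta> x = dB (\<eta> y) \<oplus>\<^bsub>B\<^esub> \<eta> z"
      using y z by (simp add: hom_add hom_diff linear_map_closed[OF A.diff_linear])
    moreover have "dB (\<eta> y) \<in> coboundaries B dB"
      unfolding coboundaries_def using y hom_closed by blast
    ultimately have "\<eta> x \<in> coboundaries B dB +>\<^bsub>B\<^esub> \<eta> z"
      unfolding a_r_coset_def' by blast
    then show ?thesis using B.M.a_repr_independence[OF _ hom_closed[OF z] IB.a_subgroup] by simp
  qed
  moreover have "z \<in> coboundaries A dA +>\<^bsub>A\<^esub> z" using z by (rule IA.a_rcos_self)
  ultimately show ?thesis unfolding cohomology_map_def by blast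
qed

text \<open>This is the form in which acyclicity of the kernel of a surjective quasi-isomorphism
  gets used: for b = 0 it says that a homogeneous cocycle in the kernel is the differential of an
  element of the kernel.\<close>

lemma lift_cocycle:
  assumes qi: "quasi_isomorphism R A dA B dB \<eta>" and surj: "\<eta> ` carrier A = carrier B"
    and c: "c \<in> homog A (i + 1)" "dA c = \<zero>\<^bsub>A\<^esub>" and b: "b \<in> homog B i" "\<eta> c = dB b"
  shows "\<exists>a\<in>homog A i. dA a = c \<and> \<eta> a = b"
proof -
  interpret IA: abelian_subgroup "coboundaries A dA" A
    by (rule coboundaries_subgroup) (rule A.cdga_axioms)
  interpret IB: abelian_subgroup "coboundaries B dB" B
    by (rule coboundaries_subgroup) (rule B.cdga_axioms)
  note dA = linear_map_closed[OF A.diff_linear] linear_map_add[OF A.diff_linear]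
  note dB = linear_map_closed[OF B.diff_linear] linear_map_add[OF B.diff_linear]
  have dA0: "dA \<zero>\<^bsub>A\<^esub> = \<zero>\<^bsub>A\<^esub>"
    by (rule linear_map_zero[OF A.module_axioms A.module_axioms A.diff_linear])
  have dAm: "dA (\<ominus>\<^bsub>A\<^esub> x) = \<ominus>\<^bsub>A\<^esub> dA x" if "x \<in> carrier A" for x
    using that dA(2)[of "\<ominus>\<^bsub>A\<^esub> x" x] dA(1) A.M.minus_equality[of "dA (\<ominus>\<^bsub>A\<^esub> x)" "dA x"] dA0
    by (simp add: A.M.l_neg)
  have dB0: "dB \<zero>\<^bsub>B\<^esub> = \<zero>\<^bsub>B\<^esub>"
    by (rule linear_map_zero[OF B.module_axioms B.module_axioms B.diff_linear])
  have dBm: "dB (\<ominus>\<^bsub>B\<^esub> x) = \<ominus>\<^bsub>B\<^esub> dB x" if "x \<in> carrier B" for x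
    using that dB(2)[of "\<ominus>\<^bsub>B\<^esub> x" x] dB(1) B.M.minus_equality[of "dB (\<ominus>\<^bsub>B\<^esub> x)" "dB x"] dB0
    by (simp add: B.M.l_neg)
  note cc = A.homog_carrier[OF c(1)] and bc = B.homog_carrier[OF b(1)]
  have bij: "bij_betw (cohomology_map B dB \<eta>) (carrier (cohomology A dA)) (carrier (cohomology B dB))"
    using qi unfolding quasi_isomorphism_def ring_iso_def by blast

  \<comment> \<open>The class of \<eta>(c) = db is zero, so injectivity makes c a
    coboundary.\<close>
  have "cohomology_map B dB \<eta> (coboundaries A dA +>\<^bsub>A\<^esub> c) =
      cohomology_map B dB \<eta> (coboundaries A dA +>\<^bsub>A\<^esub> \<zero>\<^bsub>A\<^esub>)"
  proof -
    have "\<eta> c \<in> coboundaries B dB" unfolding b(2) coboundaries_def using bc by blast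
    then have "coboundaries B dB +>\<^bsub>B\<^esub> \<eta> c = coboundaries B dB"
      using B.M.a_coset_join2[OF hom_closed[OF cc] IB.a_subgroup] by blast
    then show ?thesis using cc IB.a_subset by (simp add: cohomology_map_class hom_zero)
  qed
  then have "coboundaries A dA +>\<^bsub>A\<^esub> c = coboundaries A dA +>\<^bsub>A\<^esub> \<zero>\<^bsub>A\<^esub>"
    by (rule inj_onD[OF bij_betw_imp_inj_on[OF bij]]) (use cc c dA0 in \<open>auto simp: cohomology_carrier\<close>)
  then have "c \<in> coboundaries A dA"
    using IA.a_rcos_self[OF cc] A.M.a_coset_add_zero[OF IA.a_subset] by simp
  then obtain a where a: "a \<in> carrier A" "dA a = c" unfolding coboundaries_def by blast

  \<comment> \<open>The defect \<open>b'\<close> is a cocycle because db = \<eta>(c) = \<eta>(da) =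
    d(\<eta>(a)).\<close>
  define b' where "b' = b \<oplus>\<^bsub>B\<^esub> \<ominus>\<^bsub>B\<^esub> \<eta> a"
  have b': "b' \<in> carrier B" "dB b' = \<zero>\<^bsub>B\<^esub>"
    using a bc b(2) hom_diff[OF a(1)] hom_closed[OF a(1)] dB(1)[OF bc]
    by (simp_all add: b'_def dB dBm B.M.r_neg)
  then have "coboundaries B dB +>\<^bsub>B\<^esub> b' \<in> carrier (cohomology B dB)"
    unfolding cohomology_carrier by blast
  then obtain z where z: "z \<in> carrier A" "dA z = \<zero>\<^bsub>A\<^esub>"
    "cohomology_map B dB \<eta> (coboundaries A dA +>\<^bsub>A\<^esub> z) = coboundaries B dB +>\<^bsub>B\<^esub> b'"
    unfolding bij_betw_imp_surj_on[OF bij, symmetric] unfolding cohomology_carrier by blast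
  have "b' \<in> coboundaries B dB +>\<^bsub>B\<^esub> \<eta> z"
    using IB.a_rcos_self[OF b'(1)] z by (simp add: cohomology_map_class)
  then obtain u where u: "u \<in> carrier B" "b' = dB u \<oplus>\<^bsub>B\<^esub> \<eta> z"
    unfolding a_r_coset_def' coboundaries_def by blast
  obtain t where t: "t \<in> carrier A" "u = \<eta> t" using u(1) surj by blast

  \<comment> \<open>The added term is a cocycle, so \<open>dA a'\<close> is still c, and \<eta> maps
    it to du + \<eta>(z), which is exactly the defect.\<close>
  define a' where "a' = a \<oplus>\<^bsub>A\<^esub> (dA t \<oplus>\<^bsub>A\<^esub> z)"
  have a': "a' \<in> carrier A" using a t z dA by (simp add: a'_def)
  have da': "dA a' = c" using a t z dA cc A.diff_diff by (simp add: a'_def)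
  have "\<eta> a' = \<eta> a \<oplus>\<^bsub>B\<^esub> b'"
    using a t z dA u by (simp add: a'_def hom_add hom_diff)
  also have "\<dots> = b"
    using bc hom_closed[OF a(1)] by (simp add: b'_def B.M.a_lcomm[of "\<eta> a"] B.M.r_neg)
  finally have ea': "\<eta> a' = b" .

  \<comment> \<open>The differential has degree 1 and \<eta> degree 0, while c and b are
    homogeneous; so both equations survive projection to degree i.\<close>
  let ?a = "component A i a'"
  have "dA ?a = component A (i + 1) c"
    using component_linear_map[OF A.graded_module_axioms A.graded_module_axioms A.diff_linear
        A.diff_degree a', of i] da' by simp
  then have "dA ?a = c" using A.component_of_homog[OF c(1), of "i + 1"] by simp
  moreover have "component B i (\<eta> a') = \<eta> ?a"
    using component_linear_map[OF A.graded_module_axioms B.graded_module_axioms hom_linear, of 0 a' i]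
      hom_homog a' by simp
  then have "\<eta> ?a = b" unfolding ea' using B.component_of_homog[OF b(1), of i] by simp
  ultimately show ?thesis using A.component_homog[OF a', of i] by blast
qed

end

section \<open>Lifting a free model along its filtration\<close>

text \<open>The Leibniz rule for 1 = 1 * 1 in degree 0 gives d1 = d1 + d1.\<close>

lemma (in cdga) diff_one: "d \<one>\<^bsub>A\<^esub> = \<zero>\<^bsub>A\<^esub>"
proof -
  have c: "d \<one>\<^bsub>A\<^esub> \<in> carrier A" using linear_map_closed[OF diff_linear] by simp
  have "d (\<one>\<^bsub>A\<^esub> \<otimes>\<^bsub>A\<^esub> \<one>\<^bsub>A\<^esub>) = d \<one>\<^bsub>A\<^esub> \<otimes>\<^bsub>A\<^esub> \<one>\<^bsub>A\<^esub> \<oplus>\<^bsub>A\<^esub> signed A 0 (\<one>\<^bsub>A\<^esub> \<otimes>\<^bsub>A\<^esub> d \<one>\<^bsub>A\<^esub>)"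
    by (rule leibniz) (use one_homog in simp_all)
  then have "d \<one>\<^bsub>A\<^esub> = d \<one>\<^bsub>A\<^esub> \<oplus>\<^bsub>A\<^esub> d \<one>\<^bsub>A\<^esub>" using c by (simp add: signed_def)
  then show ?thesis using c M.add.l_cancel_one' by metis
qed

locale cdga_model = V: graded_module R V + L: cdga R "free_gca R V" d
  for R :: "('r, 'm) ring_scheme" (structure) and V :: "('r, 'v) grmod" and d
begin

sublocale free_gca_algebra R V
  by unfold_locales

text \<open>Both composites of the lift with the differentials are derivations along the lift, with
  the same signs since f preserves degrees, so agreement on generators propagates to products. The
  statement is relative to W because a partial lift is a chain map on one stage only.\<close>

lemma gca_lift_diff:
  assumes A: "cdga R A dA" and f: "graded_linear_on R V (carrier V) A f"
    and W: "W \<subseteq> carrier V" "graded_module R (grade_sub V W)"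
    and gen: "\<And>v. v \<in> W \<Longrightarrow> dA (f v) = gca_lift R A f (d (gca_incl R V v))"
    and x: "x \<in> sub_gca R V W"
  shows "gca_lift R A f (d x) = dA (gca_lift R A f x)"
proof -
  interpret A: cdga R A dA by fact
  interpret f: free_gca_lift R V A f by unfold_locales fact
  note phi = linear_map_closed[OF f.gca_lift_linear] linear_map_add[OF f.gca_lift_linear]
    linear_map_smult[OF f.gca_lift_linear]
    linear_map_zero[OF L.module_axioms A.module_axioms f.gca_lift_linear]
  note dA = linear_map_closed[OF A.diff_linear] linear_map_add[OF A.diff_linear]
    linear_map_smult[OF A.diff_linear] linear_map_zero[OF A.module_axioms A.module_axioms A.diff_linear]
  note dL = linear_map_closed[OF L.diff_linear] linear_map_add[OF L.diff_linear]
    linear_map_smult[OF L.diff_linear] linear_map_zero[OF L.module_axioms L.module_axioms L.diff_linear]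
  note phi_mult = ring_hom_mult[OF f.gca_lift_ring_hom]
  have phi_uminus: "gca_lift R A f (\<ominus>\<^bsub>\<Lambda>V\<^esub> y) = \<ominus>\<^bsub>A\<^esub> gca_lift R A f y" if "y \<in> carrier \<Lambda>V" for y
    using phi(2)[of "\<ominus>\<^bsub>\<Lambda>V\<^esub> y" y] phi(1,4) that
      A.M.minus_equality[of "gca_lift R A f (\<ominus>\<^bsub>\<Lambda>V\<^esub> y)" "gca_lift R A f y"]
    by (simp add: L.M.l_neg)
  have phi_signed: "gca_lift R A f (signed \<Lambda>V k y) = signed A k (gca_lift R A f y)"
    if "y \<in> carrier \<Lambda>V" for k y
    using that phi_uminus by (simp add: signed_def)
  show ?thesis using x W
  proof (induction rule: sub_gca_induct)
    case one
    then show ?case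
      using ring_hom_one[OF f.gca_lift_ring_hom] L.diff_one A.diff_one phi(4) by simp
  next
    case (incl_mult v i x)
    have v: "gca_incl R V v \<in> carrier \<Lambda>V" "gca_incl R V v \<in> homog \<Lambda>V i" "v \<in> carrier V"
      using incl_mult W(1) gca_incl_closed gca_incl_homog by auto
    have fv: "f v \<in> homog A i" "f v \<in> carrier A"
      using graded_linear_on_homog[OF f] graded_linear_on_closed[OF f] incl_mult v by auto
    have s: "signed \<Lambda>V i (gca_incl R V v \<otimes>\<^bsub>\<Lambda>V\<^esub> d x) \<in> carrier \<Lambda>V"
      using v incl_mult dL by (simp add: signed_def)
    have "gca_lift R A f (d (gca_incl R V v \<otimes>\<^bsub>\<Lambda>V\<^esub> x)) =
        gca_lift R A f (d (gca_incl R V v) \<otimes>\<^bsub>\<Lambda>V\<^esub> x \<oplus>\<^bsub>\<Lambda>V\<^esub> signed \<Lambda>V i (gca_incl R V v \<otimes>\<^bsub>\<Lambda>V\<^esub> d x))"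
      using L.leibniz[OF v(2) incl_mult(3)] by simp
    also have "\<dots> = dA (f v) \<otimes>\<^bsub>A\<^esub> gca_lift R A f x \<oplus>\<^bsub>A\<^esub> signed A i (f v \<otimes>\<^bsub>A\<^esub> dA (gca_lift R A f x))"
      using v s incl_mult by (simp add: phi phi_mult phi_signed dL gen f.gca_lift_incl)
    also have "\<dots> = dA (f v \<otimes>\<^bsub>A\<^esub> gca_lift R A f x)"
      using A.leibniz[OF fv(1)] phi(1)[OF incl_mult(3)] by simp
    also have "\<dots> = dA (gca_lift R A f (gca_incl R V v \<otimes>\<^bsub>\<Lambda>V\<^esub> x))"
      using v incl_mult by (simp add: phi_mult f.gca_lift_incl)
    finally show ?case .
  qed (simp_all add: phi dA dL)
qed

text \<open>Two algebra homomorphisms that agree on the generators from W agree on all of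
  \<Lambda>W.\<close>

lemma gca_lift_compose:
  assumes f: "graded_linear_on R V (carrier V) A f" and A: "graded_comm_algebra R A"
    and B: "graded_comm_algebra R B"
    and \<eta>: "\<eta> \<in> ring_hom A B" "linear_map R A B \<eta>"
    and \<psi>: "\<psi> \<in> ring_hom \<Lambda>V B" "linear_map R \<Lambda>V B \<psi>"
    and W: "W \<subseteq> carrier V" "graded_module R (grade_sub V W)"
    and gen: "\<And>v. v \<in> W \<Longrightarrow> \<eta> (f v) = \<psi> (gca_incl R V v)"
    and x: "x \<in> sub_gca R V W"
  shows "\<eta> (gca_lift R A f x) = \<psi> x"
proof -
  interpret A: graded_comm_algebra R A by fact
  interpret B: graded_comm_algebra R B by fact
  interpret f: free_gca_lift R V A f by unfold_locales fact
  note phi = linear_map_closed[OF f.gca_lift_linear] linear_map_add[OF f.gca_lift_linear]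
    linear_map_smult[OF f.gca_lift_linear] ring_hom_mult[OF f.gca_lift_ring_hom]
    linear_map_zero[OF L.module_axioms A.module_axioms f.gca_lift_linear]
    ring_hom_one[OF f.gca_lift_ring_hom]
  note eta = linear_map_add[OF \<eta>(2)] linear_map_smult[OF \<eta>(2)] ring_hom_mult[OF \<eta>(1)]
    linear_map_zero[OF A.module_axioms B.module_axioms \<eta>(2)] ring_hom_one[OF \<eta>(1)]
  note psi = linear_map_add[OF \<psi>(2)] linear_map_smult[OF \<psi>(2)] ring_hom_mult[OF \<psi>(1)]
    linear_map_zero[OF L.module_axioms B.module_axioms \<psi>(2)] ring_hom_one[OF \<psi>(1)]
  show ?thesis using x W
  proof (induction rule: sub_gca_induct)
    case (incl_mult v i x)
    then have "v \<in> carrier V" using W(1) by blast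
    then show ?case
      using incl_mult graded_linear_on_closed[OF f, of v] gen[of v]
      by (simp add: phi eta psi gca_incl_closed f.gca_lift_incl)
  qed (simp_all add: phi eta psi)
qed

end

theorem cdga_lift:
  fixes R :: "('r, 'm) ring_scheme" and V :: "('r, 'v) grmod"
  assumes V: "graded_module R V" and \<Lambda>V: "cdga R (free_gca R V) d" and filtration: "model_filtration R V d Vs"
    and A: "cdga R A dA" and B: "cdga R B dB"
    and \<psi>: "cdga_morphism R (free_gca R V) d B dB \<psi>"
    and \<eta>: "quasi_isomorphism R A dA B dB \<eta>" and surj: "\<eta> ` carrier A = carrier B"
  shows "\<exists>\<phi>. cdga_morphism R (free_gca R V) d A dA \<phi> \<and>
    (\<forall>x\<in>carrier (free_gca R V). \<eta> (\<phi> x) = \<psi> x)"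
proof -
  interpret A: cdga R A dA by fact
  interpret B: cdga R B dB by fact
  interpret L: cdga R "free_gca R V" d by fact
  interpret V: graded_module R V by fact
  interpret cdga_model R V d by unfold_locales
  interpret \<eta>: cdga_hom R A dA B dB \<eta>
    using \<eta> unfolding quasi_isomorphism_def by unfold_locales blast
  interpret \<psi>: cdga_hom R "free_gca R V" d B dB \<psi>
    using \<psi> by unfold_locales

  let ?\<iota> = "gca_incl R V"
  have Vs: "graded_free_submodule R V (Vs k)" "Vs k \<subseteq> Vs (Suc k)" "Vs 0 = {\<zero>\<^bsub>V\<^esub>}"
    "carrier V = (\<Union>k. Vs k)"
    and d_Vs: "v \<in> Vs (Suc k) \<Longrightarrow> d (?\<iota> v) \<in> sub_gca R V (Vs k)"
    and "\<exists>W. graded_free_submodule R V W \<and> internal_direct_sum V (Vs (Suc k)) (Vs k) W" for k v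
    using filtration unfolding model_filtration_def by blast+
  then obtain W where W: "\<And>k. graded_free_submodule R V (W k)"
    "\<And>k. internal_direct_sum V (Vs (Suc k)) (Vs k) (W k)" by metis
  interpret filt: graded_filtration R V Vs W
    using Vs W unfolding graded_free_submodule_def graded_free_module_def
    by (intro graded_filtration.intro graded_filtration_axioms.intro V) blast+
  have VsV: "Vs k \<subseteq> carrier V" for k using Vs(4) by blast
  have WV: "W k \<subseteq> carrier V" for k using V.submoduleE(1)[OF filt.W_submodule] .
  have W_Vs: "W k \<subseteq> Vs (Suc k)" for k
  proof
    fix w assume w: "w \<in> W k"
    have "\<zero>\<^bsub>V\<^esub> \<oplus>\<^bsub>V\<^esub> w \<in> Vs (Suc k)"
      using W(2)[of k] w subgroup.one_closed[OF submodule.axioms(1)[OF filt.U_submodule[of k]]]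
      unfolding internal_direct_sum_def set_add_def' by auto
    then show "w \<in> Vs (Suc k)" using subsetD[OF WV w] by simp
  qed

  note dA = linear_map_closed[OF A.diff_linear] linear_map_add[OF A.diff_linear]
    linear_map_smult[OF A.diff_linear] linear_map_zero[OF A.module_axioms A.module_axioms A.diff_linear]
  note dL = linear_map_closed[OF L.diff_linear] linear_map_add[OF L.diff_linear]
    linear_map_smult[OF L.diff_linear] linear_map_zero[OF L.module_axioms L.module_axioms L.diff_linear]
  note \<iota> = gca_incl_closed gca_incl_add gca_incl_smult
  have \<iota>0: "?\<iota> \<zero>\<^bsub>V\<^esub> = \<zero>\<^bsub>free_gca R V\<^esub>"
    using gca_incl_smult[OF A.R.zero_closed V.M.zero_closed] gca_incl_closed[OF V.M.zero_closed] by simp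

  \<comment> \<open>All partial lifts are kept total on \<open>V\<close>, with conditions only on \<open>V(k)\<close>: the algebra
    \<open>\<Lambda>(V(k))\<close> is only available as a subset of \<open>\<Lambda>V\<close>, on which \<open>gca_lift\<close> of a total map makes sense.\<close>
  define good where "good f k \<longleftrightarrow> graded_linear_on R V (carrier V) A f \<and>
    (\<forall>v\<in>Vs k. dA (f v) = gca_lift R A f (d (?\<iota> v)) \<and> \<eta> (f v) = \<psi> (?\<iota> v))" for f k

  \<comment> \<open>Agreement on V(k) is part of the claim: it makes the stages compatible, so that
    their union is defined.\<close>
  have step: "\<exists>f'. good f' (Suc k) \<and> (\<forall>v\<in>Vs k. f' v = f v)" if "good f k" for f k
  proof -
    have f: "graded_linear_on R V (carrier V) A f"
      and f_good: "\<And>v. v \<in> Vs k \<Longrightarrow> dA (f v) = gca_lift R A f (d (?\<iota> v))"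
        "\<And>v. v \<in> Vs k \<Longrightarrow> \<eta> (f v) = \<psi> (?\<iota> v)"
      using that unfolding good_def by auto
    interpret f: free_gca_lift R V A f by unfold_locales fact
    let ?\<phi> = "gca_lift R A f"
    note phi = linear_map_closed[OF f.gca_lift_linear] linear_map_add[OF f.gca_lift_linear]
      linear_map_smult[OF f.gca_lift_linear]
      linear_map_zero[OF L.module_axioms A.module_axioms f.gca_lift_linear]
    \<comment> \<open>The lift of the old f is used here, not that of the extension under
      construction. Its value on dw is already final for w in V(k+1), and it makes the condition
      linear in the pair (w, a).\<close>
    define P where "P w a \<longleftrightarrow> dA a = ?\<phi> (d (?\<iota> w)) \<and> \<eta> a = \<psi> (?\<iota> w)" for w a
    have P_add: "P (v \<oplus>\<^bsub>V\<^esub> w) (a \<oplus>\<^bsub>A\<^esub> b)"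
      if "v \<in> carrier V" "w \<in> carrier V" "a \<in> carrier A" "b \<in> carrier A" "P v a" "P w b" for v w a b
      using that by (simp add: P_def dA dL phi \<iota> \<eta>.hom_add \<psi>.hom_add)
    have P_smult: "P (r \<odot>\<^bsub>V\<^esub> v) (r \<odot>\<^bsub>A\<^esub> a)"
      if "r \<in> carrier R" "v \<in> carrier V" "a \<in> carrier A" "P v a" for r v a
      using that by (simp add: P_def dA dL phi \<iota> \<eta>.hom_smult \<psi>.hom_smult)
    have "\<exists>h. graded_linear_on R (grade_sub V (W k)) (carrier (grade_sub V (W k))) A h \<and>
        (\<forall>x\<in>carrier (grade_sub V (W k)). P x (h x))"
    proof (rule graded_free_module_lift)
      show "graded_free_module R (grade_sub V (W k))"
        using W(1) unfolding graded_free_submodule_def by blast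
      show "P \<zero>\<^bsub>grade_sub V (W k)\<^esub> \<zero>\<^bsub>A\<^esub>"
        by (simp add: P_def \<iota>0 dA dL phi \<eta>.hom_zero \<psi>.hom_zero)
      show "\<exists>a\<in>homog A i. P w a" if "w \<in> homog (grade_sub V (W k)) i" for i w
      proof -
        have w: "w \<in> homog V i" "w \<in> W k" "w \<in> carrier V" "w \<in> Vs (Suc k)"
          using that WV W_Vs by auto
        let ?x = "d (?\<iota> w)"
        have x: "?x \<in> sub_gca R V (Vs k)" "?x \<in> carrier (free_gca R V)" "?x \<in> homog (free_gca R V) (i + 1)"
          using d_Vs[OF w(4)] dL \<iota> w L.diff_degree[OF gca_incl_homog[OF w(1)]] by auto
        \<comment> \<open>dw lies in \<Lambda>(V(k)), where the old lift commutes with the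
          differentials; since ddw = 0, its image is a cocycle.\<close>
        have "dA (?\<phi> ?x) = ?\<phi> (d ?x)"
          by (rule gca_lift_diff[OF A f VsV filt.U_graded f_good(1) x(1), symmetric])
        then have "dA (?\<phi> ?x) = \<zero>\<^bsub>A\<^esub>" using L.diff_diff[OF \<iota>(1)[OF w(3)]] phi by simp
        moreover have "\<eta> (?\<phi> ?x) = dB (\<psi> (?\<iota> w))"
          using gca_lift_compose[OF f A.graded_comm_algebra_axioms B.graded_comm_algebra_axioms
              \<eta>.hom_ring \<eta>.hom_linear \<psi>.hom_ring \<psi>.hom_linear VsV filt.U_graded f_good(2) x(1)]
            \<psi>.hom_diff[OF \<iota>(1)[OF w(3)]] by simp
        moreover have "\<psi> (?\<iota> w) \<in> homog B i" using \<psi>.hom_homog gca_incl_homog w by blast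
        ultimately show ?thesis
          unfolding P_def using \<eta>.lift_cocycle[OF \<eta> surj f.gca_lift_homog[OF x(3)]] by blast
      qed
    qed (use P_add P_smult subsetD[OF WV[of k]] A.graded_module_axioms in auto)
    then obtain h where "graded_linear_on R (grade_sub V (W k)) (W k) A h"
      and hP: "\<And>w. w \<in> W k \<Longrightarrow> P w (h w)" by auto
    then have "graded_linear_on R V (W k) A h"
      unfolding graded_linear_on_def linear_map_def by auto
    note h = this hP
    have "graded_linear_on R V (Vs k) A f"
      using f VsV unfolding graded_linear_on_def linear_map_def by (auto simp: subset_iff Pi_def)
    from V.graded_linear_glue[OF filt.U_submodule filt.U_graded filt.W_submodule filt.W_graded
        W(2) A.graded_module_axioms this h(1)]
    obtain g where g: "graded_linear_on R V (Vs (Suc k)) A g"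
      "\<And>v. v \<in> Vs k \<Longrightarrow> g v = f v" "\<And>v. v \<in> W k \<Longrightarrow> g v = h v" by blast
    obtain f' where f': "graded_linear_on R V (carrier V) A f'" "\<And>v. v \<in> Vs (Suc k) \<Longrightarrow> f' v = g v"
      using filt.graded_linear_extend[OF A.graded_module_axioms g(1)] by blast
    have f'f: "f' v = f v" if "v \<in> Vs k" for v
      using g(2)[OF that] f'(2)[OF subsetD[OF Vs(2) that]] by simp
    have "dA (f' v) = gca_lift R A f' (d (?\<iota> v)) \<and> \<eta> (f' v) = \<psi> (?\<iota> v)" if v: "v \<in> Vs (Suc k)" for v
    proof -
      obtain a b where ab: "a \<in> Vs k" "b \<in> W k" "v = a \<oplus>\<^bsub>V\<^esub> b"
        using v W(2)[of k] unfolding internal_direct_sum_def set_add_def' by blast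
      have c: "a \<in> carrier V" "b \<in> carrier V" using ab VsV WV by blast+
      have "f' v = f a \<oplus>\<^bsub>A\<^esub> h b"
        using graded_linear_on_add[OF f'(1) c] f'f[OF ab(1)] f'(2)[OF subsetD[OF W_Vs ab(2)]]
          g(3)[OF ab(2)] ab(3) by simp
      moreover have "P v (f a \<oplus>\<^bsub>A\<^esub> h b)"
        unfolding ab(3)
      proof (rule P_add[OF c])
        show "P a (f a)" using f_good ab(1) by (simp add: P_def)
        show "P b (h b)" using h(2) ab(2) .
        show "f a \<in> carrier A" "h b \<in> carrier A"
          using graded_linear_on_closed[OF f c(1)] graded_linear_on_closed[OF h(1) ab(2)] by auto
      qed
      \<comment> \<open>The new lift has the same value on dv as the old one, because dv involves
        only letters from V(k). This converts \<open>P\<close>, stated with the old lift, into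
        goodness of the new map.\<close>
      moreover have "gca_lift R A f' (d (?\<iota> v)) = ?\<phi> (d (?\<iota> v))"
        by (rule f.gca_lift_cong[OF VsV _ f'(1) d_Vs[OF v], symmetric]) (simp add: f'f)
      ultimately show ?thesis by (simp add: P_def)
    qed
    then show ?thesis using f'(1) f'f unfolding good_def by blast
  qed

  have "\<exists>F. \<forall>k. good (F k) k \<and> (\<forall>v\<in>Vs k. F (Suc k) v = F k v)"
  proof (rule dependent_nat_choice)
    \<comment> \<open>Since V(0) = 0, the conditions at stage 0 concern only the zero vector and the
      zero map starts the sequence.\<close>
    have z: "graded_linear_on R V (carrier V) A (\<lambda>v. \<zero>\<^bsub>A\<^esub>)"
      by (rule graded_linear_on_zero[OF A.graded_module_axioms])
    interpret z: free_gca_lift R V A "\<lambda>v. \<zero>\<^bsub>A\<^esub>" by unfold_locales fact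
    have "good (\<lambda>v. \<zero>\<^bsub>A\<^esub>) 0"
      using z linear_map_zero[OF L.module_axioms A.module_axioms z.gca_lift_linear]
      by (simp add: good_def Vs(3) \<iota>0 dA dL \<eta>.hom_zero \<psi>.hom_zero)
    then show "\<exists>f. good f 0" by blast
  qed (use step in blast)
  then obtain F where F: "\<And>k. good (F k) k" "\<And>k v. v \<in> Vs k \<Longrightarrow> F (Suc k) v = F k v" by blast
  have F_lin: "graded_linear_on R V (carrier V) A (F k)" for k using F(1) unfolding good_def by blast
  have "graded_linear_on R V (Vs k) A (F k)" for k
    using F_lin[of k] VsV[of k] unfolding graded_linear_on_def linear_map_def
    by (auto simp: subset_iff Pi_def)
  then obtain f where f: "graded_linear_on R V (carrier V) A f" "\<And>k v. v \<in> Vs k \<Longrightarrow> f v = F k v"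
    using filt.graded_linear_union[of A F] F(2) by blast
  interpret f: free_gca_lift R V A f by unfold_locales fact
  let ?\<phi> = "gca_lift R A f"
  have gen: "dA (f v) = ?\<phi> (d (?\<iota> v)) \<and> \<eta> (f v) = \<psi> (?\<iota> v)" if "v \<in> carrier V" for v
  proof -
    obtain k where "v \<in> Vs k" using \<open>v \<in> carrier V\<close> Vs(4) by blast
    \<comment> \<open>Membership in V(k+1) is what places dv in \<Lambda>(V(k)), the part on which f
      and \<open>F k\<close> induce the same lift.\<close>
    then have v: "v \<in> Vs k" "v \<in> Vs (Suc k)" using Vs(2) by auto
    have "?\<phi> (d (?\<iota> v)) = gca_lift R A (F k) (d (?\<iota> v))"
      by (rule f.gca_lift_cong[OF VsV f(2) F_lin d_Vs[OF v(2)]])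
    then show ?thesis using F(1)[of k] v(1) f(2)[OF v(1)] unfolding good_def by simp
  qed
  have V': "graded_module R (grade_sub V (carrier V))"
  proof -
    \<comment> \<open>With W all of V, the restricted record is V itself, so the relative lemmas
      specialise to the whole of \<Lambda>V.\<close>
    have "(\<lambda>i. homog V i \<inter> carrier V) = homog V" using V.homog_carrier by (intro ext) auto
    then show ?thesis using V by simp
  qed
  have "cdga_morphism R (free_gca R V) d A dA ?\<phi>"
    unfolding cdga_morphism_def
  proof (intro conjI allI ballI)
    show "?\<phi> (d x) = dA (?\<phi> x)" if "x \<in> carrier (free_gca R V)" for x
      using that gen by (intro gca_lift_diff[OF A f(1) subset_refl V']) (auto simp: sub_gca_carrier)
  qed (use f.gca_lift_ring_hom f.gca_lift_linear f.gca_lift_homog in auto)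
  moreover have "\<eta> (?\<phi> x) = \<psi> x" if "x \<in> carrier (free_gca R V)" for x
    using that gen
    by (intro gca_lift_compose[OF f(1) A.graded_comm_algebra_axioms B.graded_comm_algebra_axioms
          \<eta>.hom_ring \<eta>.hom_linear \<psi>.hom_ring \<psi>.hom_linear subset_refl V'])
       (auto simp: sub_gca_carrier)
  ultimately show ?thesis by blast
qed

theorem proposition3p4:
  fixes R :: "('r, 'm) ring_scheme"
    and A :: "('r, 'a) grmod" and dA :: "'a \<Rightarrow> 'a"
    and B :: "('r, 'b) grmod" and dB :: "'b \<Rightarrow> 'b"
    and V :: "('r, 'v) grmod" and d :: "('v list \<Rightarrow> 'r) set \<Rightarrow> ('v list \<Rightarrow> 'r) set"
    and \<eta> :: "'a \<Rightarrow> 'b" and \<psi> :: "('v list \<Rightarrow> 'r) set \<Rightarrow> 'b"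
  assumes "principal_domain R"
    and "\<one>\<^bsub>R\<^esub> \<oplus>\<^bsub>R\<^esub> \<one>\<^bsub>R\<^esub> \<in> Units R"
    and "cdga R A dA" and "cdga R B dB"
    and "cdga_morphism R A dA B dB \<eta>"
    and "cdga_morphism R (free_gca R V) d B dB \<psi>"
    and "minimal_cdga R V d"
    and "quasi_isomorphism R A dA B dB \<eta>"
    and "\<eta> ` carrier A = carrier B"
  shows "\<exists>\<phi>. cdga_morphism R (free_gca R V) d A dA \<phi> \<and>
             (\<forall>x\<in>carrier (free_gca R V). \<eta> (\<phi> x) = \<psi> x)"
proof -
  obtain Vs where "model_filtration R V d Vs"
    using assms(7) unfolding minimal_cdga_def by blast
  moreover have "graded_module R V" "cdga R (free_gca R V) d"
    using assms(7) unfolding minimal_cdga_def graded_free_module_def by auto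
  ultimately show ?thesis
    using cdga_lift[OF _ _ _ assms(3,4,6,8,9)] by simp
qed

end
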